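(* Let $N\ge 4$ be an integer and $q_3=\frac{N+1}{N-3}$. If $1<q\le q_3$ and $\lambda\in\mathbb{R}$, then there exists at most one positive solution $v$ of $$ \begin{cases} -\Delta' v=\lambda v+v^q & \text{in } S^{N-1}_+,\\ v=0 & \text{on } \partial S^{N-1}_+. \end{cases} $$
   Context: $S^{N-1}_+=\{\sigma\in S^{N-1}:\sigma_1>0\}$ is the open upper-half unit sphere in $\mathbb{R}^N$, where $\sigma=(\sigma_1,\dots,\sigma_N)$, and $\partial S^{N-1}_+=\{\sigma\in S^{N-1}:\sigma_1=0\}$. $\Delta'$ denotes the Laplacian (Laplace–Beltrami operator) on $S^{N-1}$ with its standard metric. Solutions are classical, i.e. of class $C^2\big(\overline{S^{N-1}_+}\big)$; a positive solution is one that is $>0$ in $S^{N-1}_+$. *)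

theory Defs
  imports "HOL-Analysis.Analysis"
begin

text \<open>
  The unit sphere is \<^term>\<open>sphere 0 1\<close> with the metric induced from the ambient Euclidean
  space.  Functions and vector fields are differentiated along a subset \<open>M\<close> of the sphere, with
  \<^term>\<open>at \<sigma> within M\<close>, so that only their values on \<open>M\<close> matter.  Such a derivative is in general
  not unique in the normal direction; its restriction to the tangent space at \<open>\<sigma>\<close> (the
  orthogonal complement of \<open>\<sigma>\<close>) is unique if \<open>M\<close> is the sphere or an open or closed hemisphere.
  At points of \<open>M\<close> that are interior relative to the sphere, gradient, divergence and
  Laplacian do not depend on \<open>M\<close>.
\<close>

definition tangent_proj :: "'a::euclidean_space \<Rightarrow> 'a \<Rightarrow> 'a" where
  "tangent_proj \<sigma> h = h - (h \<bullet> \<sigma>) *\<^sub>R \<sigma>"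

definition has_sphere_gradient ::
  "'a set \<Rightarrow> ('a::euclidean_space \<Rightarrow> real) \<Rightarrow> 'a \<Rightarrow> 'a \<Rightarrow> bool" where
  "has_sphere_gradient M u g \<sigma> \<longleftrightarrow>
     g \<bullet> \<sigma> = 0 \<and> (u has_derivative (\<lambda>h. g \<bullet> h)) (at \<sigma> within M)"

definition sphere_grad :: "'a set \<Rightarrow> ('a::euclidean_space \<Rightarrow> real) \<Rightarrow> 'a \<Rightarrow> 'a" where
  "sphere_grad M u \<sigma> = (THE g. has_sphere_gradient M u g \<sigma>)"

text \<open>
  The Levi-Civita connection of the sphere is the tangential part of the ambient derivative, so
  with \<open>P\<close> the tangential projection at \<open>\<sigma>\<close> and \<open>A\<close> the derivative of a tangent field \<open>X\<close>, the
  divergence of \<open>X\<close> is the trace of \<open>P A\<close> on the tangent space, which is the trace of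
  \<open>P A P\<close> on the ambient space, that is, the trace of \<open>A P\<close>.
\<close>

definition sphere_div :: "'a set \<Rightarrow> ('a::euclidean_space \<Rightarrow> 'a) \<Rightarrow> 'a \<Rightarrow> real" where
  "sphere_div M X \<sigma> =
     (\<Sum>b\<in>Basis. frechet_derivative X (at \<sigma> within M) (tangent_proj \<sigma> b) \<bullet> b)"

definition laplace_beltrami :: "'a set \<Rightarrow> ('a::euclidean_space \<Rightarrow> real) \<Rightarrow> 'a \<Rightarrow> real" where
  "laplace_beltrami M u \<sigma> = sphere_div M (sphere_grad M u) \<sigma>"

text \<open>
  Class \<open>C\<^sup>2\<close> on \<open>M\<close>, up to the boundary when \<open>M\<close> is a closed hemisphere.  Composing \<open>A \<sigma>\<close> with the
  tangential projection at \<open>\<sigma>\<close> gives again an admissible continuous choice, so the continuity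
  of \<open>A\<close> only constrains the derivative in tangential directions.
\<close>

definition C2_on_sphere_subset :: "'a set \<Rightarrow> ('a::euclidean_space \<Rightarrow> real) \<Rightarrow> bool" where
  "C2_on_sphere_subset M u \<longleftrightarrow>
     (\<forall>\<sigma>\<in>M. \<exists>g. has_sphere_gradient M u g \<sigma>) \<and>
     (\<exists>A :: 'a \<Rightarrow> 'a \<Rightarrow>\<^sub>L 'a. continuous_on M A \<and>
        (\<forall>\<sigma>\<in>M. (sphere_grad M u has_derivative blinfun_apply (A \<sigma>)) (at \<sigma> within M)))"

text \<open>
  The index \<open>k\<close> singles out the coordinate written \<open>\<sigma>\<^sub>1\<close> in the usual notation; index types
  carry no order.
\<close>

definition upper_hemisphere :: "'n::finite \<Rightarrow> (real ^ 'n) set" where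
  "upper_hemisphere k = {\<sigma> \<in> sphere 0 1. \<sigma> $ k > 0}"

definition hemisphere_boundary :: "'n::finite \<Rightarrow> (real ^ 'n) set" where
  "hemisphere_boundary k = {\<sigma> \<in> sphere 0 1. \<sigma> $ k = 0}"

text \<open>Real powers \<open>v powr q\<close> are only taken where \<open>v > 0\<close>.\<close>

definition positive_solution ::
  "'n::finite \<Rightarrow> real \<Rightarrow> real \<Rightarrow> (real ^ 'n \<Rightarrow> real) \<Rightarrow> bool" where
  "positive_solution k lam q v \<longleftrightarrow>
     C2_on_sphere_subset (closure (upper_hemisphere k)) v \<and>
     (\<forall>\<sigma>\<in>upper_hemisphere k. v \<sigma> > 0) \<and>
     (\<forall>\<sigma>\<in>upper_hemisphere k.
        - laplace_beltrami (closure (upper_hemisphere k)) v \<sigma> = lam * v \<sigma> + v \<sigma> powr q) \<and>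
     (\<forall>\<sigma>\<in>hemisphere_boundary k. v \<sigma> = 0)"

lemma great_circle_norm:
  fixes \<sigma> \<tau> :: "'a::euclidean_space"
  assumes "norm \<sigma> = 1" "norm \<tau> = 1" "\<tau> \<bullet> \<sigma> = 0"
  shows "norm (cos t *\<^sub>R \<sigma> + sin t *\<^sub>R \<tau>) = 1"
proof -
  have "\<sigma> \<bullet> \<sigma> = 1" "\<tau> \<bullet> \<tau> = 1"
    using assms by (simp_all add: dot_square_norm)
  then have "(cos t *\<^sub>R \<sigma> + sin t *\<^sub>R \<tau>) \<bullet> (cos t *\<^sub>R \<sigma> + sin t *\<^sub>R \<tau>) = cos t * cos t + sin t * sin t"
    using assms(3) by (simp add: inner_add inner_commute)
  also have "\<dots> = 1"
    using sin_cos_squared_add3 by simp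
  finally show ?thesis by (simp add: norm_eq_1)
qed

lemma closure_upper_hemisphere:
  "closure (upper_hemisphere k) = {\<sigma> \<in> sphere 0 1. \<sigma> $ k \<ge> 0}"
proof
  have "closed (sphere 0 1 \<inter> {\<sigma> :: real ^ 'a. \<sigma> $ k \<ge> 0})"
    by (intro closed_Int closed_Collect_le continuous_intros) auto
  then show "closure (upper_hemisphere k) \<subseteq> {\<sigma> \<in> sphere 0 1. \<sigma> $ k \<ge> 0}"
    by (intro closure_minimal) (auto simp: upper_hemisphere_def Int_def)
next
  show "{\<sigma> \<in> sphere 0 1. \<sigma> $ k \<ge> 0} \<subseteq> closure (upper_hemisphere k)"
  proof
    fix \<sigma> :: "real ^ 'a"
    assume "\<sigma> \<in> {\<sigma> \<in> sphere 0 1. \<sigma> $ k \<ge> 0}"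
    then have s: "norm \<sigma> = 1" "\<sigma> $ k \<ge> 0" by auto
    show "\<sigma> \<in> closure (upper_hemisphere k)"
    proof (cases "\<sigma> $ k = 0")
      case False
      then show ?thesis using s closure_subset by (fastforce simp: upper_hemisphere_def)
    next
      case True
      define c where "c t = cos t *\<^sub>R \<sigma> + sin t *\<^sub>R axis k 1" for t
      have "c (inverse (real (Suc n))) \<in> upper_hemisphere k" for n
      proof -
        have t: "0 < inverse (real (Suc n))" "inverse (real (Suc n)) < pi"
          using pi_gt3 inverse_le_1_iff[of "real (Suc n)"] by (auto simp del: inverse_le_1_iff)
        have "norm (c (inverse (real (Suc n)))) = 1"
          unfolding c_def
          by (rule great_circle_norm) (use s True in \<open>auto simp: inner_axis' norm_axis_1\<close>)
        moreover have "c (inverse (real (Suc n))) $ k > 0"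
          using t True sin_gt_zero[OF t] by (simp add: c_def axis_def)
        ultimately show ?thesis by (simp add: upper_hemisphere_def)
      qed
      moreover have "(\<lambda>n. c (inverse (real (Suc n)))) \<longlonglongrightarrow> c 0"
        unfolding c_def by (intro tendsto_intros LIMSEQ_inverse_real_of_nat)
      moreover have "c 0 = \<sigma>" by (simp add: c_def)
      ultimately show ?thesis by (metis closure_sequential)
    qed
  qed
qed

lemma has_derivative_hemisphere_unique:
  fixes f :: "real ^ 'n \<Rightarrow> 'b::real_normed_vector"
  assumes \<sigma>: "\<sigma> \<in> closure (upper_hemisphere k)" and \<tau>: "\<tau> \<bullet> \<sigma> = 0"
    and F: "(f has_derivative F) (at \<sigma> within closure (upper_hemisphere k))"
    and G: "(f has_derivative G) (at \<sigma> within closure (upper_hemisphere k))"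
  shows "F \<tau> = G \<tau>"
proof -
  let ?M = "closure (upper_hemisphere k)"
  have s: "norm \<sigma> = 1" "\<sigma> $ k \<ge> 0"
    using \<sigma> by (auto simp: closure_upper_hemisphere)
  have unit: "F t = G t" if t: "norm t = 1" "t \<bullet> \<sigma> = 0" "t $ k \<ge> 0" for t
  proof -
    define c where "c x = cos x *\<^sub>R \<sigma> + sin x *\<^sub>R t" for x :: real
    have cM: "c x \<in> ?M" if "x \<in> cbox 0 1" for x
    proof -
      have "0 \<le> x" "x \<le> pi / 2" "x \<le> pi" using that pi_gt3 by auto
      then have "cos x \<ge> 0" "sin x \<ge> 0"
        by (auto intro: cos_ge_zero sin_ge_zero)
      then show ?thesis
        using great_circle_norm[OF s(1) t(1,2), of x] s(2) t(3)
        by (simp add: closure_upper_hemisphere c_def)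
    qed
    have dc: "(c has_vector_derivative t) (at 0 within cbox 0 1)"
      unfolding c_def by (auto intro!: derivative_eq_intros)
    have D: "((f \<circ> c) has_vector_derivative H t) (at 0 within cbox 0 1)"
      if H: "(f has_derivative H) (at \<sigma> within ?M)" for H
    proof -
      have "(f has_derivative H) (at (c 0) within c ` cbox 0 1)"
        using H cM by (auto simp: c_def intro: has_derivative_subset)
      from vector_derivative_diff_chain_within[OF dc this] show ?thesis .
    qed
    show ?thesis
      by (rule vector_derivative_unique_within_closed_interval[OF _ _ D[OF F] D[OF G]]) auto
  qed
  have lin: "linear F" "linear G"
    using F G by (auto intro: has_derivative_linear)
  show ?thesis
  proof (cases "\<tau> = 0")
    case True
    then show ?thesis using lin by (simp add: linear_0)
  next
    case False
    define r where "r = (if \<tau> $ k \<ge> 0 then norm \<tau> else - norm \<tau>)"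
    have "F ((1 / r) *\<^sub>R \<tau>) = G ((1 / r) *\<^sub>R \<tau>)"
      by (rule unit) (use False \<tau> in \<open>auto simp: r_def divide_le_0_iff\<close>)
    moreover have "r \<noteq> 0" using False by (auto simp: r_def)
    ultimately show ?thesis using lin by (simp add: linear_scale)
  qed
qed

lemma has_sphere_gradient_unique:
  fixes u :: "real ^ 'n \<Rightarrow> real"
  assumes "\<sigma> \<in> closure (upper_hemisphere k)"
    and "has_sphere_gradient (closure (upper_hemisphere k)) u g \<sigma>"
    and "has_sphere_gradient (closure (upper_hemisphere k)) u g' \<sigma>"
  shows "g = g'"
proof -
  have "g \<bullet> (g - g') = g' \<bullet> (g - g')"
    by (rule has_derivative_hemisphere_unique[OF assms(1), where f = u])
       (use assms in \<open>auto simp: has_sphere_gradient_def inner_diff_left\<close>)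
  then have "(g - g') \<bullet> (g - g') = 0" by (simp add: inner_diff_left)
  then show ?thesis by simp
qed

lemma sphere_grad_eqI:
  fixes u :: "real ^ 'n \<Rightarrow> real"
  assumes "\<sigma> \<in> closure (upper_hemisphere k)"
    and "has_sphere_gradient (closure (upper_hemisphere k)) u g \<sigma>"
  shows "sphere_grad (closure (upper_hemisphere k)) u \<sigma> = g"
  unfolding sphere_grad_def using assms by (blast intro: has_sphere_gradient_unique)

lemma sphere_div_eqI:
  fixes X :: "real ^ 'n \<Rightarrow> real ^ 'n"
  assumes \<sigma>: "\<sigma> \<in> closure (upper_hemisphere k)"
    and A: "(X has_derivative A) (at \<sigma> within closure (upper_hemisphere k))"
  shows "sphere_div (closure (upper_hemisphere k)) X \<sigma> = (\<Sum>b\<in>Basis. A (tangent_proj \<sigma> b) \<bullet> b)"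
proof -
  have n: "\<sigma> \<bullet> \<sigma> = 1"
    using \<sigma> by (simp add: closure_upper_hemisphere dot_square_norm)
  have "(X has_derivative frechet_derivative X (at \<sigma> within closure (upper_hemisphere k)))
          (at \<sigma> within closure (upper_hemisphere k))"
    using A by (meson differentiableI frechet_derivative_works)
  then have "frechet_derivative X (at \<sigma> within closure (upper_hemisphere k)) (tangent_proj \<sigma> b)
      = A (tangent_proj \<sigma> b)" for b
    by (rule has_derivative_hemisphere_unique[OF \<sigma> _ _ A, rotated])
       (simp add: tangent_proj_def inner_diff_left n)
  then show ?thesis by (simp add: sphere_div_def)
qed

text \<open>Sanity check: the first-order spherical harmonics have eigenvalue \<open>N - 1\<close>.\<close>

lemma laplace_beltrami_coordinate:
  fixes \<sigma> :: "real ^ 'n"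
  assumes \<sigma>: "\<sigma> \<in> closure (upper_hemisphere k)"
  shows "laplace_beltrami (closure (upper_hemisphere k)) (\<lambda>x. x $ i) \<sigma>
           = - (real CARD('n) - 1) * \<sigma> $ i"
proof -
  let ?M = "closure (upper_hemisphere k)"
  define e :: "real ^ 'n" where "e = axis i 1"
  have e: "x $ i = e \<bullet> x" for x :: "real ^ 'n" by (simp add: e_def inner_axis')
  have nM: "x \<bullet> x = 1" if "x \<in> ?M" for x
    using that by (simp add: closure_upper_hemisphere dot_square_norm)
  have grad: "sphere_grad ?M (\<lambda>x. x $ i) x = e - (e \<bullet> x) *\<^sub>R x" if x: "x \<in> ?M" for x
  proof (rule sphere_grad_eqI[OF x])
    have "((\<lambda>y. e \<bullet> y - (e \<bullet> x) / 2 * (y \<bullet> y)) has_derivative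
        (\<lambda>h. e \<bullet> h - (e \<bullet> x) / 2 * (x \<bullet> h + h \<bullet> x))) (at x within ?M)"
      by (auto intro!: derivative_eq_intros)
    moreover have "(\<lambda>h. e \<bullet> h - (e \<bullet> x) / 2 * (x \<bullet> h + h \<bullet> x)) = (\<lambda>h. (e - (e \<bullet> x) *\<^sub>R x) \<bullet> h)"
    proof
      fix h
      have "h \<bullet> x = x \<bullet> h" by (rule inner_commute)
      then show "e \<bullet> h - (e \<bullet> x) / 2 * (x \<bullet> h + h \<bullet> x) = (e - (e \<bullet> x) *\<^sub>R x) \<bullet> h"
        by (simp add: inner_diff_left)
    qed
    ultimately have "((\<lambda>y. e \<bullet> y - (e \<bullet> x) / 2 * (y \<bullet> y)) has_derivative
        (\<lambda>h. (e - (e \<bullet> x) *\<^sub>R x) \<bullet> h)) (at x within ?M)"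
      by simp
    then have "((\<lambda>y. (e \<bullet> y - (e \<bullet> x) / 2 * (y \<bullet> y)) + (e \<bullet> x) / 2) has_derivative
        (\<lambda>h. (e - (e \<bullet> x) *\<^sub>R x) \<bullet> h)) (at x within ?M)"
      by (rule has_derivative_add_const)
    then have "((\<lambda>y. y $ i) has_derivative (\<lambda>h. (e - (e \<bullet> x) *\<^sub>R x) \<bullet> h)) (at x within ?M)"
      by (rule has_derivative_transform[OF x, rotated]) (simp add: e nM)
    then show "has_sphere_gradient ?M (\<lambda>x. x $ i) (e - (e \<bullet> x) *\<^sub>R x) x"
      by (simp add: has_sphere_gradient_def inner_diff_left nM[OF x])
  qed
  have "((\<lambda>x. e - (e \<bullet> x) *\<^sub>R x) has_derivative (\<lambda>h. - (e \<bullet> h) *\<^sub>R \<sigma> - (e \<bullet> \<sigma>) *\<^sub>R h)) (at \<sigma> within ?M)"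
    by (auto intro!: derivative_eq_intros)
  then have "(sphere_grad ?M (\<lambda>x. x $ i) has_derivative (\<lambda>h. - (e \<bullet> h) *\<^sub>R \<sigma> - (e \<bullet> \<sigma>) *\<^sub>R h))
      (at \<sigma> within ?M)"
    by (rule has_derivative_transform[OF \<sigma>, rotated]) (simp add: grad)
  then have "laplace_beltrami ?M (\<lambda>x. x $ i) \<sigma> =
      (\<Sum>b\<in>Basis. (- (e \<bullet> tangent_proj \<sigma> b) *\<^sub>R \<sigma> - (e \<bullet> \<sigma>) *\<^sub>R tangent_proj \<sigma> b) \<bullet> b)"
    unfolding laplace_beltrami_def by (rule sphere_div_eqI[OF \<sigma>])
  also have "\<dots> = (\<Sum>b\<in>Basis. - ((e \<bullet> b) * (\<sigma> \<bullet> b)) + 2 * (e \<bullet> \<sigma>) * ((\<sigma> \<bullet> b) * (\<sigma> \<bullet> b)) - (e \<bullet> \<sigma>))"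
    by (intro sum.cong refl)
       (simp add: tangent_proj_def inner_diff_left inner_diff_right inner_commute
         left_diff_distrib right_diff_distrib)
  also have "\<dots> = - (e \<bullet> \<sigma>) + 2 * (e \<bullet> \<sigma>) * (\<sigma> \<bullet> \<sigma>) - real DIM(real ^ 'n) * (e \<bullet> \<sigma>)"
    by (simp only: sum.distrib sum_subtractf sum_negf sum_distrib_left[symmetric]
        euclidean_inner[symmetric] sum_constant)
  also have "\<dots> = - (real CARD('n) - 1) * \<sigma> $ i"
    by (simp add: nM[OF \<sigma>] e algebra_simps)
  finally show ?thesis .
qed

end

theory Submission
  imports Defs
begin

text \<open>
  Rotating planes instead of translating them, the moving plane method compares a solution with
  its reflection on lunes that grow from the boundary of the hemisphere; it shows that a positive
  solution is a function of the height \<^term>\<open>\<sigma> $ k\<close> alone.  In terms of the polar angle \<open>t\<close> and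
  \<open>n = N - 2\<close> it then solves \<open>u'' + n cot t u' + lam u + u\<^sup>q = 0\<close> with \<open>u'(0) = 0 = u(pi/2)\<close>.

  For this equation there is a Pohozaev function \<open>J(t; u)\<close>, a quadratic form in \<open>(u, u')\<close> plus a multiple
  of \<open>u\<^bsup>q+1\<^esup>\<close>, with \<open>J' = G u\<^sup>2\<close>; as \<open>q\<close> is at most the critical exponent, \<open>G\<close> can change sign
  only from plus to minus, so \<open>J \<ge> 0\<close>.  If \<open>u\<^sub>1(0) < u\<^sub>2(0)\<close>, put \<open>w = u\<^sub>1/u\<^sub>2\<close> and \<open>X = w\<^sup>2 J(u\<^sub>2) - J(u\<^sub>1)\<close>, so that
  \<open>X' = 2 w w' J(u\<^sub>2)\<close>.  As long as \<open>w' > 0\<close>, \<open>X\<close> increases, and this in turn prevents \<open>w'\<close> from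
  vanishing.  But \<open>X\<close> is zero at both ends, hence \<open>J(u\<^sub>2) = 0\<close>, contradicting \<open>u\<^sub>2'(pi/2) \<noteq> 0\<close>.
\<close>

section \<open>Uniqueness for the radial equation\<close>

text \<open>The zeroth order coefficient in the equation for the difference of a solution and its
  reflection may be large and positive, so no maximum principle is available on a whole lune. It
  holds in strips along the two sides, whose width depends on \<open>lam\<close>, \<open>q\<close>
  and the supremum of \<open>v\<close>, not on the opening angle; away from the sides, compactness
  and the strong maximum principle take over. One barrier serves both sides and the edge where they
  meet, so no boundary derivatives are compared and the edge needs no separate treatment.

  With \<open>n = N - 2\<close> the bound \<open>(n + 3) / (n - 1)\<close> is
  \<open>(N + 1) / (N - 3)\<close>, the critical Sobolev exponent in dimension \<open>N - 1\<close>.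
  It says precisely that the exponent \<open>m\<close> of the Pohozaev weight is at most
  \<open>n + 1\<close>, which makes the constant part of the bracket in \<open>G\<close>
  nonnegative. The parameter \<open>lam\<close> enters \<open>G\<close> only through the coefficient
  of the squared sine, where either sign is harmless; hence \<open>lam\<close> may be any real
  number.

  The quotient \<open>w\<close> suits \<open>X\<close> because all of the Pohozaev function except
  its power term is a quadratic form: where \<open>w' = 0\<close> the two quadratic parts
  cancel.\<close>

definition radial_solution ::
  "real \<Rightarrow> real \<Rightarrow> real \<Rightarrow> (real \<Rightarrow> real) \<Rightarrow> (real \<Rightarrow> real) \<Rightarrow> bool" where
  "radial_solution n lam q u d \<longleftrightarrow>
     continuous_on {0..pi/2} u \<and> continuous_on {0..pi/2} d \<and>
     (\<forall>t\<in>{0<..<pi/2}. (u has_real_derivative d t) (at t) \<and>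
        (d has_real_derivative (- n * (cos t / sin t) * d t - lam * u t - u t powr q)) (at t)) \<and>
     (\<forall>t\<in>{0..<pi/2}. 0 < u t) \<and> u (pi/2) = 0 \<and> d 0 = 0"

text \<open>
  The weight \<open>m\<close> and the other coefficients are the unique choice (up to scaling) for which
  neither \<open>u'\<^sup>2\<close>, \<open>u u'\<close> nor \<open>u\<^bsup>q+1\<^esup>\<close> survives in the derivative along solutions.
\<close>

definition pohozaev ::
  "real \<Rightarrow> real \<Rightarrow> real \<Rightarrow> (real \<Rightarrow> real) \<Rightarrow> (real \<Rightarrow> real) \<Rightarrow> real \<Rightarrow> real" where
  "pohozaev n lam q u d t =
     (let m = 2 * n * (q + 1) / (q + 3); \<beta> = 2 * n / (q + 3) in
      sin t powr m * (d t)\<^sup>2 / 2 + \<beta> * (sin t powr (m - 1) * cos t) * u t * d t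
      + ((lam + \<beta> * (m - n)) * sin t powr m + \<beta> * (n + 1 - m) * sin t powr (m - 2)) * (u t)\<^sup>2 / 2
      + sin t powr m * u t powr (q + 1) / (q + 1))"

text \<open>With every power of the sine written as a multiple of
  \<open>a = sin t powr (m - 3)\<close>, the lowest one that differentiation produces, and with
  \<open>u t powr q\<close> as an atom \<open>U\<close>, this becomes a polynomial identity modulo
  the differential equation and the relation between sine and cosine.\<close>

lemma pohozaev_derivative:
  assumes u: "(u has_real_derivative d t) (at t)"
    and d: "(d has_real_derivative (- n * (cos t / sin t) * d t - lam * u t - u t powr q)) (at t)"
    and t: "0 < t" "t < pi/2" and pos: "u t > 0" and q: "q > 1"
    and m_def: "m = 2 * n * (q + 1) / (q + 3)" and beta_def: "\<beta> = 2 * n / (q + 3)"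
  shows "(pohozaev n lam q u d has_real_derivative
     sin t powr (m - 3) * cos t / 2 *
       (\<beta> * (n + 1 - m) * (m - 2) + (lam * \<beta> * (q - 1) + \<beta> * (m - n) * m) * (sin t)\<^sup>2) * (u t)\<^sup>2) (at t)"
proof -
  have S: "sin t > 0" using t by (intro sin_gt_zero) auto
  define a where "a = sin t powr (m - 3)"
  have p0: "sin t powr m = a * sin t ^ 3" "sin t powr (m - 1) = a * sin t ^ 2"
    "sin t powr (m - 2) = a * sin t"
    using S by (simp_all add: a_def powr_diff powr_numeral power2_eq_square power3_eq_cube)
  have dp: "((\<lambda>t. sin t powr r) has_real_derivative r * (sin t powr (r - 1)) * cos t) (at t)" for r
    using S by (auto intro!: derivative_eq_intros simp: powr_diff)
  have du: "((\<lambda>t. u t powr (q + 1)) has_real_derivative (q + 1) * (u t powr q) * d t) (at t)"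
    using DERIV_fun_powr[OF u pos, of "q + 1"] by simp
  have pu: "u t powr (q + 1) = u t * u t powr q" using pos by (simp add: powr_add)
  have c2: "(cos t)\<^sup>2 = 1 - (sin t)\<^sup>2" by (simp add: cos_squared_eq)
  \<comment> \<open>Expressing \<open>n\<close> and \<open>m\<close> through \<open>\<beta>\<close>
    removes the divisions by \<open>q + 3\<close>.\<close>
  have qn: "n = \<beta> * (q + 3) / 2" and qm: "m = \<beta> * (q + 1)" using q by (auto simp: m_def beta_def)
  have e: "sin t powr (m - 1 - 1) = a * sin t" "sin t powr (m - 2 - 1) = a"
    using p0 by (simp_all add: a_def)
  define U C x y d' where "U = u t powr q" and "C = cos t" and "x = sin t" and "y = u t" and "d' = d t"
  define D' ir where "D' = - n * (C / x) * d' - lam * y - U" and "ir = inverse (q + 1)"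
  define A0 A1 A2 UQ where "A0 = (\<lambda>t. sin t powr m)" and "A1 = (\<lambda>t. sin t powr (m - 1))"
    and "A2 = (\<lambda>t. sin t powr (m - 2))" and "UQ = (\<lambda>t. u t powr (q + 1))"
  have D: "(A0 has_real_derivative m * (a * x ^ 2) * C) (at t)"
    "(A1 has_real_derivative (m - 1) * (a * x) * C) (at t)"
    "(A2 has_real_derivative (m - 2) * a * C) (at t)"
    "(UQ has_real_derivative (q + 1) * U * d') (at t)" "(d has_real_derivative D') (at t)"
    "(u has_real_derivative d') (at t)" "(sin has_real_derivative C) (at t)" "(cos has_real_derivative - x) (at t)"
    using dp[of m] dp[of "m - 1"] dp[of "m - 2"] du p0 e u d DERIV_sin DERIV_cos
    by (simp_all add: A0_def A1_def A2_def UQ_def C_def x_def U_def d'_def D'_def y_def)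
  have v: "A0 t = a * x ^ 3" "A1 t = a * x ^ 2" "A2 t = a * x" "UQ t = y * U"
    "u t = y" "d t = d'" "sin t = x" "cos t = C"
    using p0 pu by (simp_all add: A0_def A1_def A2_def UQ_def C_def x_def U_def d'_def y_def)
  have eq: "pohozaev n lam q u d = (\<lambda>t. A0 t * (d t)\<^sup>2 / 2 + \<beta> * (A1 t * cos t) * u t * d t
      + ((lam + \<beta> * (m - n)) * A0 t + \<beta> * (n + 1 - m) * A2 t) * (u t)\<^sup>2 / 2
      + A0 t * UQ t * ir)"
    unfolding fun_eq_iff pohozaev_def Let_def m_def[symmetric] beta_def[symmetric] A0_def A1_def A2_def UQ_def
      ir_def by (simp only: divide_inverse) simp
  have x: "x \<noteq> 0" using S x_def by simp
  have q1: "q + 1 \<noteq> 0" using q by simp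
  have ir: "ir * (q + 1) = 1" using q1 by (simp add: ir_def)
  have D'x: "D' * x = - n * C * d' - (lam * y + U) * x"
    using x by (simp add: D'_def field_simps)
  have C2: "C * C = 1 - x * x" using c2 by (simp add: C_def x_def power2_eq_square)
  have dJ: "(pohozaev n lam q u d has_real_derivative
      ((m * (a * x ^ 2) * C) * d'\<^sup>2 / 2 + (a * x ^ 3) * (2 * d' * D') / 2
      + (\<beta> * ((m - 1) * (a * x) * C * C - a * x ^ 2 * x) * y * d' + \<beta> * (a * x ^ 2 * C) * (d' * d' + y * D'))
      + ((lam + \<beta> * (m - n)) * (m * (a * x ^ 2) * C) + \<beta> * (n + 1 - m) * ((m - 2) * a * C)) * y\<^sup>2 / 2
      + ((lam + \<beta> * (m - n)) * (a * x ^ 3) + \<beta> * (n + 1 - m) * (a * x)) * (2 * y * d') / 2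
      + ((m * (a * x ^ 2) * C) * (y * U) * ir + a * x ^ 3 * U * d'))) (at t)"
    unfolding eq
    apply (rule DERIV_cdivide derivative_eq_intros D refl)+
    unfolding v using ir
    apply simp
    apply algebra
    done
  have eq2: "(m * (a * x ^ 2) * C) * (y * U) * ir = \<beta> * (a * x ^ 2 * C) * (y * U)"
    using ir unfolding qm by algebra
  \<comment> \<open>An ideal membership certificate: the computed minus the claimed derivative is an
    explicit combination of the relations \<open>D'x\<close> and \<open>C2\<close>, so substituting
    these makes it vanish.\<close>
  have eq3: "(m * (a * x ^ 2) * C) * d'\<^sup>2 / 2 + (a * x ^ 3) * (2 * d' * D') / 2
      + (\<beta> * ((m - 1) * (a * x) * C * C - a * x ^ 2 * x) * y * d' + \<beta> * (a * x ^ 2 * C) * (d' * d' + y * D'))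
      + ((lam + \<beta> * (m - n)) * (m * (a * x ^ 2) * C) + \<beta> * (n + 1 - m) * ((m - 2) * a * C)) * y\<^sup>2 / 2
      + ((lam + \<beta> * (m - n)) * (a * x ^ 3) + \<beta> * (n + 1 - m) * (a * x)) * (2 * y * d') / 2
      + (\<beta> * (a * x ^ 2 * C) * (y * U) + a * x ^ 3 * U * d')
    - a * C / 2 * (\<beta> * (n + 1 - m) * (m - 2) + (lam * \<beta> * (q - 1) + \<beta> * (m - n) * m) * x\<^sup>2) * y\<^sup>2
    = (a * x\<^sup>2 * d' + \<beta> * a * x * C * y) * (D' * x - (- n * C * d' - (lam * y + U) * x))
      + \<beta> * a * x * y * d' * (m - 1 - n) * (C * C - (1 - x * x))"
    unfolding qn qm by (simp add: field_simps power2_eq_square power3_eq_cube)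
  have "(pohozaev n lam q u d has_real_derivative a * C / 2 * (\<beta> * (n + 1 - m) * (m - 2) + (lam * \<beta> * (q - 1) + \<beta> * (m - n) * m) * x\<^sup>2) * y\<^sup>2) (at t)"
    by (rule DERIV_cong[OF dJ], unfold eq2, rule iffD1[OF right_minus_eq], unfold eq3 D'x C2) simp
  then show ?thesis
    by (simp only: a_def C_def x_def y_def)
qed

lemma continuous_sin_powr: "0 < r \<Longrightarrow> continuous_on {0..pi/2} (\<lambda>t. sin t powr r)"
  by (rule continuous_on_powr', (intro continuous_intros)+) (auto simp: sin_ge_zero)

text \<open>For \<open>m > 2\<close> all three exponents of the sine are positive, so the weights
  are continuous at \<open>t = 0\<close> with the value \<open>0 powr r = 0\<close>.\<close>

lemma pohozaev_continuous:
  assumes "continuous_on {0..pi/2} u" "continuous_on {0..pi/2} d" "\<forall>t\<in>{0..pi/2}. 0 \<le> u t"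
    and q: "q > 1" and m: "2 * n * (q + 1) / (q + 3) > 2"
  shows "continuous_on {0..pi/2} (pohozaev n lam q u d)"
proof -
  define m where "m = 2 * n * (q + 1) / (q + 3)"
  have "m > 2" using m m_def by simp
  then have c: "continuous_on {0..pi/2} (\<lambda>t. sin t powr m)"
    "continuous_on {0..pi/2} (\<lambda>t. sin t powr (m - 1))"
    "continuous_on {0..pi/2} (\<lambda>t. sin t powr (m - 2))"
    by (auto intro: continuous_sin_powr)
  have cu: "continuous_on {0..pi/2} (\<lambda>t. u t powr (q + 1))"
    by (rule continuous_on_powr'[OF assms(1) continuous_on_const]) (use assms(3) q in auto)
  have cc: "continuous_on {0..pi/2} cos" by (intro continuous_intros)
  show ?thesis
    unfolding pohozaev_def[abs_def] Let_def m_def[symmetric]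
    by (intro continuous_on_add continuous_on_mult continuous_on_divide continuous_on_power
        continuous_on_const c cu cc assms(1,2)) (use q in auto)
qed

text \<open>\<open>J\<close> vanishes at \<open>0\<close>, where every power of the sine does, and
  at \<open>pi/2\<close> it is half a square. The sine is increasing and \<open>A \<ge> 0\<close>;
  so if \<open>A + B * (sin t)\<^sup>2\<close> is nonnegative at the given \<open>t\<close>, it is
  so on all of \<open>(0, t)\<close> and \<open>J\<close> has grown from \<open>0\<close>. Otherwise
  it is nonpositive from \<open>t\<close> on and \<open>J\<close> decreases towards its value at
  \<open>pi/2\<close>.\<close>

lemma pohozaev_nonneg:
  assumes s: "radial_solution n lam q u d" and n: "n \<ge> 2" and q: "q > 1" "q \<le> (n + 3) / (n - 1)"
    and t: "t \<in> {0..pi/2}"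
  shows "pohozaev n lam q u d t \<ge> 0"
proof -
  define m \<beta> where "m = 2 * n * (q + 1) / (q + 3)" and "\<beta> = 2 * n / (q + 3)"
  define A B where "A = \<beta> * (n + 1 - m) * (m - 2)" and "B = lam * \<beta> * (q - 1) + \<beta> * (m - n) * m"
  define J where "J = pohozaev n lam q u d"
  have "2 * (q + 1) \<le> n * (q + 1)" using n q by (intro mult_right_mono) auto
  then have m2: "m > 2" unfolding m_def using q by (simp add: field_simps)
  \<comment> \<open>This is where the upper bound on \<open>q\<close> enters: it is equivalent to
    \<open>m \<le> n + 1\<close>.\<close>
  have "q * (n - 1) \<le> n + 3" using q n by (simp add: pos_le_divide_eq)
  then have "m \<le> n + 1" unfolding m_def using q by (simp add: field_simps)
  moreover have "\<beta> > 0" using n q by (simp add: \<beta>_def)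
  ultimately have A: "A \<ge> 0" unfolding A_def using m2 by (intro mult_nonneg_nonneg) auto
  have c: "continuous_on {0..pi/2} u" "continuous_on {0..pi/2} d"
    and du: "\<And>t. 0 < t \<Longrightarrow> t < pi/2 \<Longrightarrow> (u has_real_derivative d t) (at t)"
    and dd: "\<And>t. 0 < t \<Longrightarrow> t < pi/2 \<Longrightarrow>
      (d has_real_derivative (- n * (cos t / sin t) * d t - lam * u t - u t powr q)) (at t)"
    and pos: "\<And>t. 0 \<le> t \<Longrightarrow> t < pi/2 \<Longrightarrow> 0 < u t" and ends: "u (pi/2) = 0" "d 0 = 0"
    using s unfolding radial_solution_def by simp_all
  have upos: "u t \<ge> 0" if "t \<in> {0..pi/2}" for t
    using pos[of t] ends that by (metis atLeastAtMost_iff less_eq_real_def)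
  have cont: "continuous_on {0..pi/2} J"
    unfolding J_def by (rule pohozaev_continuous[OF c _ q(1)]) (use upos m2 in \<open>simp_all add: m_def\<close>)
  have D: "(J has_real_derivative sin t powr (m - 3) * cos t / 2 * (A + B * (sin t)\<^sup>2) * (u t)\<^sup>2) (at t)"
    if "0 < t" "t < pi/2" for t
    unfolding J_def A_def B_def
    by (rule pohozaev_derivative[OF du dd _ _ _ q(1) m_def \<beta>_def]) (use that pos in auto)
  have J0: "J 0 = 0"
    unfolding J_def pohozaev_def Let_def m_def[symmetric] ends using m2 by simp
  have J1: "J (pi/2) \<ge> 0"
    unfolding J_def pohozaev_def Let_def ends by simp
  have wt: "sin x powr (m - 3) * cos x / 2 \<ge> 0" if "0 < x" "x < pi/2" for x
    using that by (auto intro!: mult_nonneg_nonneg cos_ge_zero)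
  show ?thesis
  proof (cases "A + B * (sin t)\<^sup>2 \<ge> 0")
    case True
    have "J 0 \<le> J t"
    proof (rule DERIV_nonneg_imp_increasing_open[of 0 t J])
      show "continuous_on {0..t} J" by (rule continuous_on_subset[OF cont]) (use t in auto)
      fix x assume x: "0 < x" "x < t"
      have "sin x \<le> sin t" "sin x \<ge> 0" using x t by (auto intro!: sin_monotone_2pi_le sin_ge_zero)
      then have "(sin x)\<^sup>2 \<le> (sin t)\<^sup>2" by (intro power_mono)
      then have "B < 0 \<Longrightarrow> B * (sin t)\<^sup>2 \<le> B * (sin x)\<^sup>2" by (intro mult_left_mono_neg) auto
      moreover have "B \<ge> 0 \<Longrightarrow> 0 \<le> B * (sin x)\<^sup>2" by simp
      ultimately have "A + B * (sin x)\<^sup>2 \<ge> 0" using True A by linarith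
      then have "sin x powr (m - 3) * cos x / 2 * (A + B * (sin x)\<^sup>2) * (u x)\<^sup>2 \<ge> 0"
        using wt[of x] x t by (intro mult_nonneg_nonneg) auto
      then show "\<exists>y. (J has_real_derivative y) (at x) \<and> y \<ge> 0"
        using D[of x] x t by auto
    qed (use t in auto)
    then show ?thesis using J0 J_def by simp
  next
    case False
    moreover have "0 \<le> B \<Longrightarrow> 0 \<le> A + B * (sin t)\<^sup>2" using A by simp
    ultimately have B: "B < 0" by (meson not_le)
    have "J t \<ge> J (pi/2)"
    proof (rule DERIV_nonpos_imp_decreasing_open[of t "pi/2" J])
      show "continuous_on {t..pi/2} J" by (rule continuous_on_subset[OF cont]) (use t in auto)
      fix x assume x: "t < x" "x < pi/2"
      have "sin t \<le> sin x" "sin t \<ge> 0" using x t by (auto intro!: sin_monotone_2pi_le sin_ge_zero)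
      then have "(sin t)\<^sup>2 \<le> (sin x)\<^sup>2" by (intro power_mono)
      then have "B * (sin x)\<^sup>2 \<le> B * (sin t)\<^sup>2" using B by (intro mult_left_mono_neg) auto
      then have "A + B * (sin x)\<^sup>2 \<le> 0" using False by linarith
      then have "sin x powr (m - 3) * cos x / 2 * (A + B * (sin x)\<^sup>2) * (u x)\<^sup>2 \<le> 0"
        using wt[of x] x t by (intro mult_nonpos_nonneg mult_nonneg_nonpos) auto
      then show "\<exists>y. (J has_real_derivative y) (at x) \<and> y \<le> 0"
        using D[of x] x t by auto
    qed (use t in auto)
    then show ?thesis using J1 J_def by simp
  qed
qed

section \<open>Gronwall estimates and Cauchy data at the two ends of the interval\<close>

lemma radial_solutionD:
  assumes "radial_solution n lam q u d"
  shows "continuous_on {0..pi/2} u" "continuous_on {0..pi/2} d"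
    and "\<And>t. 0 < t \<Longrightarrow> t < pi/2 \<Longrightarrow> (u has_real_derivative d t) (at t)"
    and "\<And>t. 0 < t \<Longrightarrow> t < pi/2 \<Longrightarrow>
      (d has_real_derivative (- n * (cos t / sin t) * d t - lam * u t - u t powr q)) (at t)"
    and "\<And>t. 0 \<le> t \<Longrightarrow> t < pi/2 \<Longrightarrow> 0 < u t" and "u (pi/2) = 0" "d 0 = 0"
  using assms unfolding radial_solution_def by simp_all

text \<open>Derivatives are asked for on the open interval only, so that the left end may be the
  singular point \<open>t = 0\<close> of the radial equation.\<close>

lemma gronwall_zero:
  fixes f :: "real \<Rightarrow> real"
  assumes "continuous_on {a..b} f" "f a = 0" "\<And>t. t \<in> {a..b} \<Longrightarrow> 0 \<le> f t"
    and "\<And>t. a < t \<Longrightarrow> t < b \<Longrightarrow> \<exists>y. (f has_real_derivative y) (at t) \<and> y \<le> C * f t"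
    and t: "t \<in> {a..b}"
  shows "f t = 0"
proof -
  define h where "h = (\<lambda>t. exp (- C * t) * f t)"
  have "h t \<le> h a"
  proof (rule DERIV_nonpos_imp_decreasing_open[of a t h])
    show "continuous_on {a..t} h" unfolding h_def
      by (intro continuous_intros continuous_on_subset[OF assms(1)]) (use t in auto)
    fix x assume x: "a < x" "x < t"
    then obtain y where y: "(f has_real_derivative y) (at x)" "y \<le> C * f x"
      using assms(4)[of x] t by auto
    have "(h has_real_derivative exp (- C * x) * (y - C * f x)) (at x)"
      unfolding h_def by (auto intro!: derivative_eq_intros y(1) simp: algebra_simps)
    moreover have "exp (- C * x) * (y - C * f x) \<le> 0" using y(2) by (intro mult_nonneg_nonpos) auto
    ultimately show "\<exists>y. (h has_real_derivative y) (at x) \<and> y \<le> 0" by blast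
  qed (use t in auto)
  then have "f t \<le> 0" using assms(2) by (simp add: h_def mult_le_0_iff)
  then show ?thesis using assms(3)[OF t] by simp
qed

text \<open>Mean value theorem; as \<open>q > 1\<close>, the slope is largest at \<open>M\<close>.
  The bound serves as a Lipschitz constant for the radial equation and later as a bound on the
  zeroth order coefficient in the moving plane argument.\<close>

lemma powr_diff_bound:
  fixes x y M q :: real
  assumes "0 < x" "x \<le> M" "0 < y" "y \<le> M" "q > 1"
  shows "\<bar>x powr q - y powr q\<bar> \<le> q * M powr (q - 1) * \<bar>x - y\<bar>"
proof -
  have *: "\<bar>x powr q - y powr q\<bar> \<le> q * M powr (q - 1) * \<bar>x - y\<bar>"
    if "0 < x" "x < y" "y \<le> M" for x y
  proof -
    have "\<exists>z. x < z \<and> z < y \<and> y powr q - x powr q = (y - x) * (q * z powr (q - 1))"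
    proof (rule MVT2)
      fix z assume "x \<le> z" "z \<le> y"
      then show "((\<lambda>z. z powr q) has_real_derivative q * z powr (q - 1)) (at z)"
        using that by (intro has_real_derivative_powr) auto
    qed (use that in auto)
    then obtain z where z: "x < z" "z < y" "y powr q - x powr q = (y - x) * (q * z powr (q - 1))" by blast
    have "z powr (q - 1) \<le> M powr (q - 1)" using z that assms by (intro powr_mono2) auto
    then have "(y - x) * (q * z powr (q - 1)) \<le> (y - x) * (q * M powr (q - 1))"
      using that assms by (intro mult_left_mono) auto
    moreover have "0 \<le> (y - x) * (q * z powr (q - 1))" using that assms by auto
    ultimately show ?thesis using z that by (simp add: abs_if mult_ac)
  qed
  show ?thesis
    using *[of x y] *[of y x] assms by (cases x y rule: linorder_cases) (auto simp: abs_minus_commute)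
qed

lemma radial_solution_bounded:
  assumes "radial_solution n lam q u d"
  obtains M where "M > 0" "\<And>t. t \<in> {0..pi/2} \<Longrightarrow> u t \<le> M"
proof -
  have "bounded (u ` {0..pi/2})"
    using radial_solutionD(1)[OF assms] by (intro compact_imp_bounded compact_continuous_image) auto
  then obtain M where "M > 0" "\<forall>t\<in>{0..pi/2}. \<bar>u t\<bar> \<le> M"
    by (auto simp: bounded_pos)
  then show ?thesis using that by fastforce
qed

text \<open>Vanishing Cauchy data at \<open>pi/2\<close> would propagate backwards and make
  \<open>u\<close> vanish. Backwards in time the damping term has the bad sign, so the estimate
  stays on \<open>[pi/4, pi/2]\<close>, where the cotangent lies between \<open>0\<close> and
  \<open>1\<close>.\<close>

lemma radial_solution_slope_end:
  assumes s: "radial_solution n lam q u d" and q: "q > 1" and n: "n \<ge> 0"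
  shows "d (pi/2) \<noteq> 0"
proof
  assume d0: "d (pi/2) = 0"
  note s' = radial_solutionD[OF s]
  obtain M where M: "M > 0" "\<And>t. t \<in> {0..pi/2} \<Longrightarrow> u t \<le> M"
    using radial_solution_bounded[OF s] by blast
  \<comment> \<open>Time is reversed, so that Gronwall applies from the endpoint \<open>pi/2\<close>.\<close>
  define f where "f t = (u (- t))\<^sup>2 + (d (- t))\<^sup>2" for t
  define C where "C = 2 * n + \<bar>lam\<bar> + M powr (q - 1) + 1"
  have "f (- (pi/4)) = 0"
  proof (rule gronwall_zero[of "- (pi/2)" "- (pi/4)" f C])
    show "continuous_on {- (pi/2)..- (pi/4)} f"
      unfolding f_def
      by (intro continuous_intros continuous_on_compose2[OF s'(1)] continuous_on_compose2[OF s'(2)]) auto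
    show "f (- (pi/2)) = 0" using d0 s' by (simp add: f_def)
    fix t assume t: "- (pi/2) < t" "t < - (pi/4)"
    define r where "r = - t"
    have r: "pi/4 < r" "r < pi/2" using t by (auto simp: r_def)
    define d' where "d' = - n * (cos r / sin r) * d r - lam * u r - u r powr q"
    have u: "(u has_real_derivative d r) (at (- t))" and d: "(d has_real_derivative d') (at (- t))"
      using s'(3,4)[of r] r by (auto simp: d'_def r_def)
    have D: "(f has_real_derivative - (2 * u r * d r) - 2 * d r * d') (at t)"
      unfolding f_def
      by (auto intro!: derivative_eq_intros DERIV_chain'[of uminus, OF _ u] DERIV_chain'[of uminus, OF _ d] simp: r_def)
    have ur: "0 < u r" "u r \<le> M" using s'(5)[of r] M r by auto
    have "sin r > 0" "cos r > 0" using r by (auto intro!: sin_gt_zero cos_gt_zero)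
    have "cos r = sin (pi/2 - r)" by (simp add: sin_diff)
    also have "\<dots> \<le> sin r" using r by (intro sin_monotone_2pi_le) auto
    finally have ct: "0 \<le> cos r / sin r" "cos r / sin r \<le> 1"
      using \<open>sin r > 0\<close> \<open>cos r > 0\<close> by auto
    have "u r powr q = u r powr (q - 1) * u r" using ur by (simp add: powr_diff)
    also have "\<dots> \<le> M powr (q - 1) * u r" using ur q by (intro mult_right_mono powr_mono2) auto
    finally have uq: "u r powr q \<le> M powr (q - 1) * u r" .
    have ab: "2 * \<bar>u r\<bar> * \<bar>d r\<bar> \<le> (u r)\<^sup>2 + (d r)\<^sup>2"
      using sum_squares_bound[of "\<bar>u r\<bar>" "\<bar>d r\<bar>"] by simp
    have "- (2 * u r * d r) - 2 * d r * d'
        = 2 * n * (cos r / sin r) * (d r)\<^sup>2 + (lam - 1) * (2 * u r * d r) + 2 * d r * u r powr q"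
      by (simp add: d'_def algebra_simps power2_eq_square)
    also have "\<dots> \<le> 2 * n * (d r)\<^sup>2 + (\<bar>lam\<bar> + 1) * (2 * \<bar>u r\<bar> * \<bar>d r\<bar>) + M powr (q - 1) * (2 * \<bar>u r\<bar> * \<bar>d r\<bar>)"
    proof (intro add_mono)
      show "2 * n * (cos r / sin r) * (d r)\<^sup>2 \<le> 2 * n * (d r)\<^sup>2"
        using ct n by (intro mult_right_mono mult_left_le) auto
      have "(lam - 1) * (2 * u r * d r) \<le> \<bar>(lam - 1) * (2 * u r * d r)\<bar>" by (rule abs_ge_self)
      also have "\<dots> = \<bar>lam - 1\<bar> * (2 * \<bar>u r\<bar> * \<bar>d r\<bar>)" by (simp add: abs_mult)
      also have "\<dots> \<le> (\<bar>lam\<bar> + 1) * (2 * \<bar>u r\<bar> * \<bar>d r\<bar>)" by (intro mult_right_mono) auto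
      finally show "(lam - 1) * (2 * u r * d r) \<le> (\<bar>lam\<bar> + 1) * (2 * \<bar>u r\<bar> * \<bar>d r\<bar>)" .
      have "2 * d r * u r powr q \<le> 2 * \<bar>d r\<bar> * u r powr q" by (intro mult_right_mono) auto
      also have "\<dots> \<le> 2 * \<bar>d r\<bar> * (M powr (q - 1) * u r)" using uq by (intro mult_left_mono) auto
      finally show "2 * d r * u r powr q \<le> M powr (q - 1) * (2 * \<bar>u r\<bar> * \<bar>d r\<bar>)"
        using ur by (simp add: mult_ac)
    qed
    also have "\<dots> \<le> 2 * n * ((u r)\<^sup>2 + (d r)\<^sup>2) + (\<bar>lam\<bar> + 1) * ((u r)\<^sup>2 + (d r)\<^sup>2) + M powr (q - 1) * ((u r)\<^sup>2 + (d r)\<^sup>2)"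
      using ab n by (intro add_mono mult_left_mono) auto
    also have "\<dots> = C * f t" by (simp add: C_def f_def r_def algebra_simps)
    finally show "\<exists>y. (f has_real_derivative y) (at t) \<and> y \<le> C * f t" using D by blast
  qed (auto simp: f_def)
  then have "u (pi/4) = 0" by (simp add: f_def)
  then show False using s'(5)[of "pi/4"] by simp
qed

text \<open>Forwards from the singular point the unbounded cotangent does no harm: it enters the
  derivative of \<open>f\<close> only through the nonpositive term
  \<open>- (2 * n * c * z\<^sup>2)\<close>, which is dropped. Both slopes are \<open>0\<close> at
  the start, so equal values suffice.\<close>

lemma radial_solution_unique_initial:
  assumes s1: "radial_solution n lam q u1 d1" and s2: "radial_solution n lam q u2 d2"
    and q: "q > 1" and n: "n \<ge> 0" and eq: "u1 0 = u2 0" and t: "t \<in> {0..pi/2}"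
  shows "u1 t = u2 t"
proof -
  note s1' = radial_solutionD[OF s1] and s2' = radial_solutionD[OF s2]
  obtain M1 where M1: "M1 > 0" "\<And>t. t \<in> {0..pi/2} \<Longrightarrow> u1 t \<le> M1"
    using radial_solution_bounded[OF s1] by blast
  obtain M2 where M2: "M2 > 0" "\<And>t. t \<in> {0..pi/2} \<Longrightarrow> u2 t \<le> M2"
    using radial_solution_bounded[OF s2] by blast
  define M where "M = max M1 M2"
  define f where "f t = (u1 t - u2 t)\<^sup>2 + (d1 t - d2 t)\<^sup>2" for t
  define C where "C = \<bar>lam\<bar> + q * M powr (q - 1) + 1"
  have "f t = 0"
  proof (rule gronwall_zero[of 0 "pi/2" f C])
    show "continuous_on {0..pi/2} f"
      unfolding f_def by (intro continuous_intros s1' s2')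
    show "f 0 = 0" using eq s1' s2' by (simp add: f_def)
    fix r assume r: "0 < r" "r < pi/2"
    define y z where "y = u1 r - u2 r" and "z = d1 r - d2 r"
    define c where "c = cos r / sin r"
    have D: "(f has_real_derivative 2 * y * z
        + 2 * z * (- n * c * z - lam * y - (u1 r powr q - u2 r powr q))) (at r)"
      unfolding f_def y_def z_def
      by (auto intro!: derivative_eq_intros s1'(3,4)[OF r, folded c_def] s2'(3,4)[OF r, folded c_def] simp: algebra_simps)
    have ct: "0 \<le> c"
      unfolding c_def using r by (intro divide_nonneg_nonneg sin_ge_zero cos_ge_zero) auto
    have ab: "2 * \<bar>y\<bar> * \<bar>z\<bar> \<le> y\<^sup>2 + z\<^sup>2"
      using sum_squares_bound[of "\<bar>y\<bar>" "\<bar>z\<bar>"] by simp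
    have pw: "\<bar>u1 r powr q - u2 r powr q\<bar> \<le> q * M powr (q - 1) * \<bar>y\<bar>"
      unfolding y_def M_def
      using s1'(5)[of r] s2'(5)[of r] M1(2)[of r] M2(2)[of r] r q by (intro powr_diff_bound) auto
    have "2 * y * z + 2 * z * (- n * c * z - lam * y - (u1 r powr q - u2 r powr q))
        = - (2 * n * c * z\<^sup>2) + (1 - lam) * (2 * y * z) + (- (2 * z * (u1 r powr q - u2 r powr q)))"
      by (simp add: algebra_simps power2_eq_square)
    also have "\<dots> \<le> 0 + (\<bar>lam\<bar> + 1) * (2 * \<bar>y\<bar> * \<bar>z\<bar>) + q * M powr (q - 1) * (2 * \<bar>y\<bar> * \<bar>z\<bar>)"
    proof (intro add_mono)
      show "- (2 * n * c * z\<^sup>2) \<le> 0" using ct n by (simp del: times_divide_eq_right)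
      have "(1 - lam) * (2 * y * z) \<le> \<bar>(1 - lam) * (2 * y * z)\<bar>" by (rule abs_ge_self)
      also have "\<dots> = \<bar>1 - lam\<bar> * (2 * \<bar>y\<bar> * \<bar>z\<bar>)" by (simp add: abs_mult)
      also have "\<dots> \<le> (\<bar>lam\<bar> + 1) * (2 * \<bar>y\<bar> * \<bar>z\<bar>)" by (intro mult_right_mono) auto
      finally show "(1 - lam) * (2 * y * z) \<le> (\<bar>lam\<bar> + 1) * (2 * \<bar>y\<bar> * \<bar>z\<bar>)" .
      have "- (2 * z * (u1 r powr q - u2 r powr q)) \<le> \<bar>2 * z * (u1 r powr q - u2 r powr q)\<bar>"
        by (rule abs_ge_minus_self)
      also have "\<dots> = 2 * \<bar>z\<bar> * \<bar>u1 r powr q - u2 r powr q\<bar>" by (simp add: abs_mult)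
      also have "\<dots> \<le> 2 * \<bar>z\<bar> * (q * M powr (q - 1) * \<bar>y\<bar>)" using pw by (intro mult_left_mono) auto
      finally show "- (2 * z * (u1 r powr q - u2 r powr q)) \<le> q * M powr (q - 1) * (2 * \<bar>y\<bar> * \<bar>z\<bar>)"
        by (simp add: mult_ac)
    qed
    also have "\<dots> \<le> 0 + (\<bar>lam\<bar> + 1) * (y\<^sup>2 + z\<^sup>2) + q * M powr (q - 1) * (y\<^sup>2 + z\<^sup>2)"
      using ab q by (intro add_mono mult_left_mono) auto
    also have "\<dots> = C * f r" by (simp add: C_def f_def y_def z_def algebra_simps)
    finally show "\<exists>y. (f has_real_derivative y) (at r) \<and> y \<le> C * f r" using D by blast
  qed (use t in \<open>auto simp: f_def\<close>)
  then show ?thesis by (simp add: f_def sum_power2_eq_zero_iff)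
qed

text \<open>\<open>W\<close> is the Wronskian, so \<open>w' = W / u2\<^sup>2\<close>. At a first
  zero of \<open>W\<close> the Cauchy data of \<open>u1\<close> are \<open>w\<close> times those of
  \<open>u2\<close>, so only the power terms survive in \<open>X\<close>; the sign of
  \<open>X\<close> then shows \<open>w \<le> 1\<close> there, which is incompatible with a zero of
  \<open>W\<close>.\<close>

lemma radial_solution_initial_not_less:
  assumes s1: "radial_solution n lam q u1 d1" and s2: "radial_solution n lam q u2 d2"
    and n: "n \<ge> 2" and q: "q > 1" "q \<le> (n + 3) / (n - 1)"
  shows "\<not> u1 0 < u2 0"
proof
  assume less: "u1 0 < u2 0"
  note s1' = radial_solutionD[OF s1] and s2' = radial_solutionD[OF s2]
  define m where "m = 2 * n * (q + 1) / (q + 3)"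
  define J1 J2 where "J1 = pohozaev n lam q u1 d1" and "J2 = pohozaev n lam q u2 d2"
  define w where "w t = u1 t / u2 t" for t
  define W where "W t = d1 t * u2 t - u1 t * d2 t" for t
  define X where "X t = (w t)\<^sup>2 * J2 t - J1 t" for t
  have "2 * (q + 1) \<le> n * (q + 1)" using n q by (intro mult_right_mono) auto
  then have m2: "m > 2" unfolding m_def using q by (simp add: field_simps)
  have u1: "0 \<le> u1 t" and u2: "0 \<le> u2 t" if "t \<in> {0..pi/2}" for t
    using s1'(5)[of t] s2'(5)[of t] s1'(6) s2'(6) that by (metis atLeastAtMost_iff less_eq_real_def)+
  have cJ: "continuous_on {0..pi/2} J1" "continuous_on {0..pi/2} J2"
    unfolding J1_def J2_def using u1 u2 q m2 s1' s2'
    by (auto intro!: pohozaev_continuous simp: m_def)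
  have J2: "J2 t \<ge> 0" if "t \<in> {0..pi/2}" for t
    unfolding J2_def using pohozaev_nonneg[OF s2 n q that] .
  have J0: "J1 0 = 0" "J2 0 = 0"
    unfolding J1_def J2_def pohozaev_def Let_def m_def[symmetric] s1' s2' using m2 by simp_all
  have Jend: "J1 (pi/2) = (d1 (pi/2))\<^sup>2 / 2" "J2 (pi/2) = (d2 (pi/2))\<^sup>2 / 2"
    unfolding J1_def J2_def pohozaev_def Let_def s1' s2' using q by simp_all
  have dw: "(w has_real_derivative W t / (u2 t)\<^sup>2) (at t)" if "0 < t" "t < pi/2" for t
    unfolding w_def[abs_def] W_def
    using s2'(5)[of t] that
    by (auto intro!: derivative_eq_intros s1'(3) s2'(3) simp: power2_eq_square)
  have cw: "continuous_on {0..t} w" if "t < pi/2" for t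
    unfolding w_def[abs_def]
    by (intro continuous_on_divide continuous_on_subset[OF s1'(1)] continuous_on_subset[OF s2'(1)])
       (use that s2'(5) in force)+
  have cX: "continuous_on {0..t} X" if "t < pi/2" for t
    unfolding X_def[abs_def]
    by (intro continuous_intros cw that continuous_on_subset[OF cJ(1)] continuous_on_subset[OF cJ(2)])
      (use that in auto)
  have cW: "continuous_on {0..pi/2} W"
    unfolding W_def[abs_def] by (intro continuous_intros s1' s2')
  have dX: "(X has_real_derivative 2 * w t * (W t / (u2 t)\<^sup>2) * J2 t) (at t)" if t: "0 < t" "t < pi/2" for t
  proof -
    define G where "G = sin t powr (m - 3) * cos t / 2 *
       (2 * n / (q + 3) * (n + 1 - m) * (m - 2) + (lam * (2 * n / (q + 3)) * (q - 1) + 2 * n / (q + 3) * (m - n) * m) * (sin t)\<^sup>2)"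
    have "(J1 has_real_derivative G * (u1 t)\<^sup>2) (at t)" "(J2 has_real_derivative G * (u2 t)\<^sup>2) (at t)"
      unfolding J1_def J2_def G_def
      using pohozaev_derivative[OF s1'(3,4)[OF t] t _ q(1) m_def refl]
        pohozaev_derivative[OF s2'(3,4)[OF t] t _ q(1) m_def refl] s1'(5)[of t] s2'(5)[of t] t by auto
    then have "(X has_real_derivative 2 * w t * (W t / (u2 t)\<^sup>2) * J2 t + (w t)\<^sup>2 * (G * (u2 t)\<^sup>2) - G * (u1 t)\<^sup>2) (at t)"
      unfolding X_def[abs_def]
      by (auto intro!: derivative_eq_intros dw t simp: algebra_simps)
    moreover have "(w t)\<^sup>2 * (G * (u2 t)\<^sup>2) = G * (u1 t)\<^sup>2"
      using s2'(5)[of t] t by (simp add: w_def power_divide)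
    ultimately show ?thesis by simp
  qed
  \<comment> \<open>\<open>sin t powr n\<close> is the integrating factor of the Wronskian equation:
    it removes the cotangent term, and the remaining source has the sign of
    \<open>u2 - u1\<close>.\<close>
  define V where "V t = sin t powr n * W t" for t
  have dV: "(V has_real_derivative
      sin t powr n * (u1 t * u2 t * (u2 t powr (q - 1) - u1 t powr (q - 1)))) (at t)"
    if t: "0 < t" "t < pi/2" for t
  proof -
    have S: "sin t > 0" using t by (intro sin_gt_zero) auto
    have "((\<lambda>t. sin t powr n) has_real_derivative n * (sin t powr (n - 1)) * cos t) (at t)"
      using DERIV_fun_powr[OF DERIV_sin S, of n] by simp
    moreover have "(W has_real_derivative (- n * (cos t / sin t) * W t
        + (u1 t * u2 t powr q - u1 t powr q * u2 t))) (at t)"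
      unfolding W_def[abs_def]
      by (auto intro!: derivative_eq_intros s1'(3,4)[OF t] s2'(3,4)[OF t] simp: algebra_simps)
    ultimately have "(V has_real_derivative n * (sin t powr (n - 1)) * cos t * W t
      + (- n * (cos t / sin t) * W t + (u1 t * u2 t powr q - u1 t powr q * u2 t)) * sin t powr n) (at t)"
      unfolding V_def[abs_def] by (rule DERIV_mult)
    moreover have "sin t powr (n - 1) = sin t powr n / sin t" using S by (simp add: powr_diff)
    moreover have "u1 t powr q = u1 t powr (q - 1) * u1 t" "u2 t powr q = u2 t powr (q - 1) * u2 t"
      using s1'(5)[of t] s2'(5)[of t] t by (auto simp: powr_diff)
    ultimately show ?thesis by (simp add: algebra_simps)
  qed
  have cV: "continuous_on {0..pi/2} V"
    unfolding V_def[abs_def] by (intro continuous_intros continuous_sin_powr cW) (use n in auto)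
  have Vpos: "V r > 0" if r: "0 < r" "r < pi/2" and lt: "\<And>t. 0 \<le> t \<Longrightarrow> t < r \<Longrightarrow> u1 t < u2 t" for r
  proof -
    have "V 0 < V r"
    proof (rule DERIV_pos_imp_increasing_open[of 0 r V])
      fix x assume x: "0 < x" "x < r"
      then have xp: "0 < u1 x" "0 < u2 x" "x < pi/2" using s1'(5)[of x] s2'(5)[of x] r by auto
      moreover have "u1 x powr (q - 1) < u2 x powr (q - 1)"
        using lt[of x] x xp q by (intro powr_less_mono2) auto
      moreover have "sin x > 0" using x r by (intro sin_gt_zero) auto
      ultimately have "sin x powr n * (u1 x * u2 x * (u2 x powr (q - 1) - u1 x powr (q - 1))) > 0" by simp
      then show "\<exists>y. (V has_real_derivative y) (at x) \<and> 0 < y" using dV[of x] x xp by blast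
    qed (use r in \<open>auto intro: continuous_on_subset[OF cV]\<close>)
    then show ?thesis by (simp add: V_def)
  qed
  have WV: "W t > 0 \<longleftrightarrow> V t > 0" if "0 < t" "t < pi/2" for t
    using sin_gt_zero[of t] that by (simp add: V_def zero_less_mult_iff)
  have Xmono: "X s \<le> X t" if st: "0 \<le> s" "s \<le> t" "t < pi/2" and W: "\<And>x. 0 < x \<Longrightarrow> x < t \<Longrightarrow> W x > 0" for s t
  proof (rule DERIV_nonneg_imp_increasing_open[of s t X])
    fix x assume x: "s < x" "x < t"
    have "0 < W x" "0 < u1 x" "0 < u2 x" "0 \<le> J2 x"
      using W[of x] x st s1'(5)[of x] s2'(5)[of x] J2[of x] by auto
    then have "2 * w x * (W x / (u2 x)\<^sup>2) * J2 x \<ge> 0" by (simp add: w_def)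
    then show "\<exists>y. (X has_real_derivative y) (at x) \<and> 0 \<le> y" using dX[of x] x st by fastforce
  qed (use st in \<open>auto intro: continuous_on_subset[OF cX[of t]]\<close>)
  have X0: "X 0 = 0" using J0 by (simp add: X_def)

  have Wpos: "W t > 0" if t: "0 < t" "t < pi/2" for t
  proof (rule ccontr)
    assume "\<not> 0 < W t"
    have "((\<lambda>t. u2 t - u1 t) \<longlongrightarrow> u2 0 - u1 0) (at 0 within {0..pi/2})"
      using s1'(1) s2'(1) by (intro tendsto_diff) (auto simp: continuous_on_def)
    then have "\<forall>\<^sub>F t in at 0 within {0..pi/2}. u2 t - u1 t > 0"
      using less by (intro order_tendstoD(1)) auto
    then obtain \<delta> where \<delta>: "\<delta> > 0" "\<And>t. t \<in> {0..pi/2} \<Longrightarrow> t \<noteq> 0 \<Longrightarrow> dist t 0 < \<delta> \<Longrightarrow> u2 t - u1 t > 0"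
      unfolding eventually_at by blast
    define \<eta> where "\<eta> = min \<delta> t"
    have lt0: "u1 x < u2 x" if "0 \<le> x" "x < \<eta>" for x
      using \<delta>(2)[of x] that t less by (cases "x = 0") (auto simp: \<eta>_def)
    have Vsmall: "V x > 0" if "0 < x" "x \<le> \<eta>" for x
      using that t by (intro Vpos lt0) (auto simp: \<eta>_def)
    have eta: "0 < \<eta>" "\<eta> \<le> t" using \<delta> t by (auto simp: \<eta>_def)
    have Vt: "V t \<le> 0" using WV[OF t] \<open>\<not> 0 < W t\<close> by auto
    \<comment> \<open>Since \<open>V 0 = 0\<close>, the first zero is sought beyond
      \<open>\<eta>\<close>; on \<open>(0, \<eta>]\<close> positivity is known.\<close>
    define Z where "Z = {x \<in> {\<eta>..t}. V x \<le> 0}"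
    have cV': "continuous_on {\<eta>..t} V" by (rule continuous_on_subset[OF cV]) (use eta t in auto)
    have "closed Z" unfolding Z_def using cV' by (intro continuous_on_closed_Collect_le) auto
    moreover have "Z \<noteq> {}" "bdd_below Z" using Vt eta by (auto simp: Z_def intro!: bdd_belowI[of _ \<eta>])
    ultimately have "Inf Z \<in> Z" by (intro closed_contains_Inf)
    define r where "r = Inf Z"
    have r: "\<eta> \<le> r" "r \<le> t" "V r \<le> 0" using \<open>Inf Z \<in> Z\<close> by (auto simp: r_def Z_def)
    have before: "V x > 0" if "0 < x" "x < r" for x
    proof (cases "x \<le> \<eta>")
      case False
      have "x \<notin> Z" using that cInf_lower[OF _ \<open>bdd_below Z\<close>, of x] by (auto simp: r_def)
      then show ?thesis using False that r by (auto simp: Z_def)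
    qed (use Vsmall that in auto)
    have "\<exists>x\<ge>\<eta>. x \<le> r \<and> V x = 0"
      using r eta Vsmall[of \<eta>] by (intro IVT2' continuous_on_subset[OF cV']) auto
    then have "V r = 0" using before eta r by (metis less_le_trans order_less_irrefl order_le_less)
    have r': "0 < r" "r < pi/2" using r eta t by auto
    have S: "sin r > 0" using r' by (intro sin_gt_zero) auto
    have W0: "W r = 0" using \<open>V r = 0\<close> S by (simp add: V_def)
    have ur: "u1 r > 0" "u2 r > 0" using s1'(5)[of r] s2'(5)[of r] r' by auto
    have wr: "w r > 0" "u1 r = w r * u2 r" using ur by (auto simp: w_def)
    have d1: "d1 r = w r * d2 r" using W0 ur by (simp add: W_def w_def field_simps)
    have "X r = sin r powr m * u2 r powr (q + 1) / (q + 1) * ((w r)\<^sup>2 - w r powr (q + 1))"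
      unfolding X_def J1_def J2_def pohozaev_def Let_def m_def[symmetric] d1 unfolding wr(2)
      using wr(1) ur(2) by (simp add: powr_mult power_mult_distrib algebra_simps add_divide_distrib
          diff_divide_distrib) (simp add: power2_eq_square)
    moreover have "X r \<ge> 0"
      using Xmono[of 0 r] X0 r' before WV by force
    moreover have "sin r powr m * u2 r powr (q + 1) / (q + 1) > 0" using S ur q by simp
    ultimately have "w r powr (q + 1) \<le> (w r)\<^sup>2" by (metis diff_ge_0_iff_ge zero_le_mult_iff less_le_not_le)
    then have "w r \<le> 1"
      using powr_less_mono[of 2 "q + 1" "w r"] q wr(1) by (fastforce simp: powr_numeral)
    \<comment> \<open>\<open>w\<close> increases strictly up to \<open>r\<close>, so
      \<open>w r \<le> 1\<close> forces \<open>w < 1\<close> before \<open>r\<close>. Then the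
      source of \<open>V\<close> is positive on all of \<open>(0, r)\<close>, and \<open>V\<close>
      cannot return to \<open>0\<close> at \<open>r\<close>.\<close>
    have "u1 x < u2 x" if x: "0 \<le> x" "x < r" for x
    proof -
      have "w x < w r"
      proof (rule DERIV_pos_imp_increasing_open[of x r w])
        fix y assume y: "x < y" "y < r"
        then have "W y / (u2 y)\<^sup>2 > 0" using before[of y] WV[of y] s2'(5)[of y] x r' by auto
        then show "\<exists>d. (w has_real_derivative d) (at y) \<and> 0 < d" using dw[of y] x y r' by force
      qed (use x r' in \<open>auto intro: continuous_on_subset[OF cw[of r]]\<close>)
      then have "u1 x / u2 x < 1" using \<open>w r \<le> 1\<close> by (simp add: w_def)
      then show ?thesis using s2'(5)[of x] x r' by (simp add: divide_less_eq split: if_splits)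
    qed
    then have "V r > 0" using Vpos[of r] r' by blast
    then show False using \<open>V r = 0\<close> by simp
  qed

  have d2: "d2 (pi/2) \<noteq> 0" using radial_solution_slope_end[OF s2] q n by simp
  have lim: "(f \<longlongrightarrow> f (pi/2)) (at_left (pi/2))" if "continuous_on {0..pi/2} f" for f :: "real \<Rightarrow> real"
    using that by (intro continuous_on_Icc_at_leftD) auto
  have ev: "eventually (\<lambda>t. t \<in> {0<..<pi/2}) (at_left (pi/2))"
    by (rule eventually_at_left_real) simp
  \<comment> \<open>At \<open>pi/2\<close> the quotient is \<open>0 / 0\<close>, which evaluates to
    \<open>0\<close>. The end value that makes \<open>X\<close> vanish is the left limit of
    \<open>w\<close>, the quotient of the slopes.\<close>
  have "(w \<longlongrightarrow> d1 (pi/2) / d2 (pi/2)) (at_left (pi/2))"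
    unfolding w_def[abs_def]
  proof (rule lhopital_left)
    show "(u1 \<longlongrightarrow> 0) (at_left (pi/2))" "(u2 \<longlongrightarrow> 0) (at_left (pi/2))"
      using lim[OF s1'(1)] lim[OF s2'(1)] s1'(6) s2'(6) by auto
    show "\<forall>\<^sub>F x in at_left (pi/2). u2 x \<noteq> 0"
      by (rule eventually_mono[OF ev])
        (metis greaterThanLessThan_iff less_imp_le order_less_irrefl s2'(5))
    show "\<forall>\<^sub>F x in at_left (pi/2). d2 x \<noteq> 0"
      by (rule tendsto_imp_eventually_ne[OF lim[OF s2'(2)] d2])
    show "\<forall>\<^sub>F x in at_left (pi/2). (u1 has_real_derivative d1 x) (at x)"
      using ev by eventually_elim (use s1'(3) in auto)
    show "\<forall>\<^sub>F x in at_left (pi/2). (u2 has_real_derivative d2 x) (at x)"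
      using ev by eventually_elim (use s2'(3) in auto)
    show "((\<lambda>x. d1 x / d2 x) \<longlongrightarrow> d1 (pi/2) / d2 (pi/2)) (at_left (pi/2))"
      by (intro tendsto_divide lim s1' s2' d2)
  qed
  then have "(X \<longlongrightarrow> (d1 (pi/2) / d2 (pi/2))\<^sup>2 * J2 (pi/2) - J1 (pi/2)) (at_left (pi/2))"
    unfolding X_def[abs_def] by (intro tendsto_intros lim cJ)
  then have Xlim: "(X \<longlongrightarrow> 0) (at_left (pi/2))" using d2 by (simp add: Jend power_divide)
  have Xz: "X t = 0" if t: "0 < t" "t < pi/2" for t
  proof -
    have "\<forall>\<^sub>F x in at_left (pi/2). X t \<le> X x"
      using eventually_at_left_real[OF t(2)]
      by eventually_elim (use t Wpos in \<open>auto intro!: Xmono\<close>)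
    then have "X t \<le> 0" by (intro tendsto_lowerbound[OF Xlim]) auto
    moreover have "X 0 \<le> X t" using t Wpos by (intro Xmono) auto
    ultimately show ?thesis using X0 by simp
  qed
  have J2z: "J2 t = 0" if t: "0 < t" "t < pi/2" for t
  proof -
    have "((\<lambda>_. 0) has_real_derivative 2 * w t * (W t / (u2 t)\<^sup>2) * J2 t) (at t)"
      by (rule has_field_derivative_transform_within_open[OF dX[OF t], of "{0<..<pi/2}"]) (use t Xz in auto)
    then have "2 * w t * (W t / (u2 t)\<^sup>2) * J2 t = 0" by (rule DERIV_unique) simp
    then show ?thesis using Wpos[OF t] s1'(5)[of t] s2'(5)[of t] t by (simp add: w_def)
  qed
  have "\<forall>\<^sub>F t in at_left (pi/2). J2 t = 0" using ev by eventually_elim (use J2z in auto)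
  then have "(J2 \<longlongrightarrow> 0) (at_left (pi/2))" by (rule tendsto_eventually)
  then have "J2 (pi/2) = 0" using lim[OF cJ(2)] by (intro tendsto_unique) auto
  then show False using d2 by (simp add: Jend)
qed

theorem radial_solution_unique:
  assumes "radial_solution n lam q u1 d1" "radial_solution n lam q u2 d2"
    and "n \<ge> 2" "q > 1" "q \<le> (n + 3) / (n - 1)" "t \<in> {0..pi/2}"
  shows "u1 t = u2 t"
proof -
  have "u1 0 = u2 0"
    using radial_solution_initial_not_less[OF assms(1,2)] radial_solution_initial_not_less[OF assms(2,1)]
      assms by fastforce
  then show ?thesis using radial_solution_unique_initial[OF assms(1,2)] assms by simp
qed

section \<open>Laplacian and maximum principles on the sphere\<close>

text \<open>
  Functions on the sphere are composed with \<^const>\<open>sgn\<close>, i.e. extended to be homogeneous of degree 0;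
  on the unit sphere the Euclidean Laplacian of the extension is the Laplace-Beltrami operator.
\<close>

definition has_laplacian :: "('a::euclidean_space \<Rightarrow> real) \<Rightarrow> real \<Rightarrow> 'a \<Rightarrow> bool" where
  "has_laplacian f L x \<longleftrightarrow> (\<exists>G H. (\<forall>\<^sub>F y in nhds x. (f has_derivative (\<lambda>h. G y \<bullet> h)) (at y)) \<and>
     (G has_derivative H) (at x) \<and> L = (\<Sum>b\<in>Basis. H b \<bullet> b))"

lemma has_laplacianI:
  "\<lbrakk>\<forall>\<^sub>F y in nhds x. (f has_derivative (\<lambda>h. G y \<bullet> h)) (at y); (G has_derivative H) (at x);
    L = (\<Sum>b\<in>Basis. H b \<bullet> b)\<rbrakk> \<Longrightarrow> has_laplacian f L x"
  unfolding has_laplacian_def by blast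

lemma has_laplacianE:
  assumes "has_laplacian f L x"
  obtains G H where "\<forall>\<^sub>F y in nhds x. (f has_derivative (\<lambda>h. G y \<bullet> h)) (at y)"
    "(G has_derivative H) (at x)" "L = (\<Sum>b\<in>Basis. H b \<bullet> b)"
  using assms unfolding has_laplacian_def by blast

lemma eventually_nhds_compose:
  "isCont g x \<Longrightarrow> \<forall>\<^sub>F y in nhds (g x). P y \<Longrightarrow> \<forall>\<^sub>F y in nhds x. P (g y)"
  by (rule eventually_compose_filterlim) (simp_all add: isCont_def tendsto_at_iff_tendsto_nhds)

lemma has_laplacian_add:
  assumes "has_laplacian f L x" "has_laplacian g M x"
  shows "has_laplacian (\<lambda>y. f y + g y) (L + M) x"
proof -
  obtain G H where G: "\<forall>\<^sub>F y in nhds x. (f has_derivative (\<lambda>h. G y \<bullet> h)) (at y)"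
      "(G has_derivative H) (at x)" "L = (\<Sum>b\<in>Basis. H b \<bullet> b)"
    by (rule has_laplacianE[OF assms(1)])
  obtain G' H' where G': "\<forall>\<^sub>F y in nhds x. (g has_derivative (\<lambda>h. G' y \<bullet> h)) (at y)"
      "(G' has_derivative H') (at x)" "M = (\<Sum>b\<in>Basis. H' b \<bullet> b)"
    by (rule has_laplacianE[OF assms(2)])
  have "\<forall>\<^sub>F y in nhds x. ((\<lambda>y. f y + g y) has_derivative (\<lambda>h. (G y + G' y) \<bullet> h)) (at y)"
    using G(1) G'(1) by eventually_elim (auto simp: inner_add_left intro: has_derivative_add)
  moreover have "((\<lambda>y. G y + G' y) has_derivative (\<lambda>h. H h + H' h)) (at x)"
    by (intro has_derivative_add G G')
  moreover have "L + M = (\<Sum>b\<in>Basis. (H b + H' b) \<bullet> b)"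
    by (simp add: G G' inner_add_left sum.distrib)
  ultimately show ?thesis by (rule has_laplacianI)
qed

lemma has_laplacian_cmult:
  assumes "has_laplacian f L x"
  shows "has_laplacian (\<lambda>y. c * f y) (c * L) x"
proof -
  obtain G H where G: "\<forall>\<^sub>F y in nhds x. (f has_derivative (\<lambda>h. G y \<bullet> h)) (at y)"
      "(G has_derivative H) (at x)" "L = (\<Sum>b\<in>Basis. H b \<bullet> b)"
    by (rule has_laplacianE[OF assms(1)])
  have "\<forall>\<^sub>F y in nhds x. ((\<lambda>y. c * f y) has_derivative (\<lambda>h. (c *\<^sub>R G y) \<bullet> h)) (at y)"
    using G(1) by eventually_elim (auto intro: has_derivative_mult_right)
  moreover have "((\<lambda>y. c *\<^sub>R G y) has_derivative (\<lambda>h. c *\<^sub>R H h)) (at x)"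
    by (intro has_derivative_scaleR_right G)
  moreover have "c * L = (\<Sum>b\<in>Basis. (c *\<^sub>R H b) \<bullet> b)"
    by (simp add: G sum_distrib_left)
  ultimately show ?thesis by (rule has_laplacianI)
qed

lemma has_laplacian_const: "has_laplacian (\<lambda>y. c) 0 x"
  by (rule has_laplacianI[where G = "\<lambda>_. 0" and H = "\<lambda>_. 0"]) simp_all

text \<open>\<open>S\<close> is its own inverse, so this is the invariance of the trace under
  conjugation. After expansion the corrections are \<open>- 2\<close>, \<open>- 2\<close> and
  \<open>4\<close> times \<open>H b \<bullet> b\<close>.\<close>

lemma trace_reflection:
  fixes H :: "'a::euclidean_space \<Rightarrow> 'a"
  assumes H: "linear H" and b: "norm b = 1"
  defines "S \<equiv> \<lambda>y. y - (2 * (y \<bullet> b)) *\<^sub>R b"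
  shows "(\<Sum>e\<in>Basis. S (H (S e)) \<bullet> e) = (\<Sum>e\<in>Basis. H e \<bullet> e)"
proof -
  have bb: "b \<bullet> b = 1" using b by (simp add: norm_eq_1)
  have Hb: "(\<Sum>e\<in>Basis. (b \<bullet> e) *\<^sub>R H e) = H b"
    using linear_sum[OF H, of "\<lambda>e. (b \<bullet> e) *\<^sub>R e" Basis] H
    by (simp add: linear_scale euclidean_representation)
  have S: "S (H (S e)) \<bullet> e = H e \<bullet> e - 2 * (((b \<bullet> e) *\<^sub>R H e) \<bullet> b)
      - 2 * ((b \<bullet> e) * (H b \<bullet> e)) + 4 * (H b \<bullet> b) * ((b \<bullet> e) * (b \<bullet> e))" for e
    unfolding S_def using H
    by (simp add: linear_diff linear_scale inner_diff_left inner_diff_right inner_commute algebra_simps)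
  have "(\<Sum>e\<in>Basis. S (H (S e)) \<bullet> e) = (\<Sum>e\<in>Basis. H e \<bullet> e) - 2 * ((\<Sum>e\<in>Basis. (b \<bullet> e) *\<^sub>R H e) \<bullet> b)
      - 2 * (b \<bullet> H b) + 4 * (H b \<bullet> b) * (b \<bullet> b)"
    unfolding S sum.distrib sum_subtractf sum_distrib_left[symmetric] inner_sum_left
    by (simp only: euclidean_inner[of b "H b"] euclidean_inner[of b b])
  then show ?thesis unfolding Hb bb by (simp add: inner_commute[of b "H b"])
qed

text \<open>As \<open>S\<close> is linear and symmetric, the chain rule turns the gradient into
  \<open>S (G (S y))\<close> and its derivative into the conjugate of \<open>H\<close> by
  \<open>S\<close>, which has the same trace.\<close>

lemma has_laplacian_reflection:
  assumes b: "norm b = 1" and S_def: "S = (\<lambda>y. y - (2 * (y \<bullet> b)) *\<^sub>R b)"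
    and L: "has_laplacian f L (S x)"
  shows "has_laplacian (\<lambda>y. f (S y)) L x"
proof -
  obtain G H where G: "\<forall>\<^sub>F y in nhds (S x). (f has_derivative (\<lambda>h. G y \<bullet> h)) (at y)"
      "(G has_derivative H) (at (S x))" "L = (\<Sum>b\<in>Basis. H b \<bullet> b)"
    by (rule has_laplacianE[OF L])
  have bl: "bounded_linear S" unfolding S_def
    by (intro bounded_linear_sub bounded_linear_ident bounded_linear_compose[OF bounded_linear_scaleR_left]
      bounded_linear_const_mult bounded_linear_inner_left)
  then have dS: "(S has_derivative S) (at y within A)" for y A
    by (rule bounded_linear_imp_has_derivative)
  have sym: "S y \<bullet> z = y \<bullet> S z" for y z
    by (simp add: S_def inner_diff_left inner_diff_right inner_commute mult.commute)
  have "isCont S x" using bl by (rule linear_continuous_at)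
  then have "\<forall>\<^sub>F y in nhds x. (f has_derivative (\<lambda>h. G (S y) \<bullet> h)) (at (S y))"
    using G(1) by (rule eventually_nhds_compose)
  then have "\<forall>\<^sub>F y in nhds x. ((\<lambda>y. f (S y)) has_derivative (\<lambda>h. S (G (S y)) \<bullet> h)) (at y)"
    by eventually_elim (use has_derivative_compose[OF dS] sym in auto)
  moreover have "((\<lambda>y. S (G (S y))) has_derivative (\<lambda>h. S (H (S h)))) (at x)"
    using has_derivative_compose[OF has_derivative_compose[OF dS G(2)] dS] .
  moreover have "L = (\<Sum>e\<in>Basis. S (H (S e)) \<bullet> e)"
    unfolding G(3) S_def by (rule trace_reflection[symmetric]) (use G(2) b in \<open>auto intro: has_derivative_linear\<close>)
  ultimately show ?thesis by (rule has_laplacianI)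
qed

text \<open>Differentiability of \<open>G\<close> at the single point \<open>x\<close> suffices.
  Along a line in direction \<open>b\<close> the slope \<open>g\<close> vanishes at
  \<open>0\<close>; were its derivative \<open>H b \<bullet> b\<close> negative, the slope would be
  negative just after \<open>0\<close> and \<open>f\<close> would drop below its minimum.\<close>

lemma has_laplacian_local_min:
  assumes L: "has_laplacian f L x" and m: "\<forall>\<^sub>F y in nhds x. f x \<le> f y"
  shows "0 \<le> L"
proof -
  obtain G H where G: "\<forall>\<^sub>F y in nhds x. (f has_derivative (\<lambda>h. G y \<bullet> h)) (at y)"
      "(G has_derivative H) (at x)" "L = (\<Sum>b\<in>Basis. H b \<bullet> b)"
    by (rule has_laplacianE[OF L])
  have "0 \<le> H b \<bullet> b" for b
  proof (rule ccontr)
    assume neg: "\<not> 0 \<le> H b \<bullet> b"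
    define l where "l t = x + t *\<^sub>R b" for t :: real
    define g where "g t = G (l t) \<bullet> b" for t
    have dl: "(l has_derivative (\<lambda>t. t *\<^sub>R b)) (at t)" for t
      unfolding l_def by (auto intro!: derivative_eq_intros)
    have l0: "l 0 = x" by (simp add: l_def)
    have "(g has_derivative (\<lambda>t. H (t *\<^sub>R b) \<bullet> b)) (at 0)"
      unfolding g_def by (rule has_derivative_inner_left, rule has_derivative_compose[OF dl]) (simp add: l0 G)
    moreover have "linear H" using G(2) by (rule has_derivative_linear)
    ultimately have dg: "(g has_real_derivative (H b \<bullet> b)) (at 0)"
      by (simp add: has_field_derivative_def linear_scale mult.commute[of _ "H b \<bullet> b"])
    have "isCont l 0" unfolding l_def by (intro continuous_intros)
    then have "\<forall>\<^sub>F t in nhds 0. (f has_derivative (\<lambda>h. G (l t) \<bullet> h)) (at (l t)) \<and> f (l 0) \<le> f (l t)"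
      by (rule eventually_nhds_compose) (use eventually_conj[OF G(1) m] l0 in simp)
    then obtain d where d: "d > 0" "\<And>t. \<bar>t\<bar> < d \<Longrightarrow> (f has_derivative (\<lambda>h. G (l t) \<bullet> h)) (at (l t))"
        "\<And>t. \<bar>t\<bar> < d \<Longrightarrow> f (l 0) \<le> f (l t)"
      unfolding eventually_nhds_metric by (auto simp: dist_real_def)
    have df: "((\<lambda>t. f (l t)) has_real_derivative g t) (at t)" if "\<bar>t\<bar> < d" for t
    proof -
      have "((\<lambda>t. f (l t)) has_derivative (\<lambda>s. G (l t) \<bullet> (s *\<^sub>R b))) (at t)"
        by (rule has_derivative_compose[OF dl d(2)[OF that]])
      then show ?thesis by (simp add: has_field_derivative_def g_def mult.commute[of _ "G (l t) \<bullet> b"])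
    qed
    have g0: "g 0 = 0"
      by (rule DERIV_local_min[OF df[of 0] d(1)]) (use d in auto)
    obtain d' where d': "d' > 0" "\<And>h. 0 < h \<Longrightarrow> h < d' \<Longrightarrow> g h < 0"
      using has_real_derivative_neg_dec_right[OF dg] neg g0 by auto
    define r where "r = min d d' / 2"
    have r: "0 < r" "r < d" "r < d'" using d(1) d'(1) by (auto simp: r_def)
    have "f (l 0) > f (l r)"
    proof (rule DERIV_neg_imp_decreasing_open[of 0 r "\<lambda>t. f (l t)"])
      fix s assume "0 < s" "s < r"
      then show "\<exists>y. ((\<lambda>t. f (l t)) has_real_derivative y) (at s) \<and> y < 0"
        using df[of s] d'(2)[of s] r by auto
    next
      show "continuous_on {0..r} (\<lambda>t. f (l t))"
        by (rule DERIV_continuous_on[of _ _ g]) (use df r in \<open>auto intro: has_field_derivative_at_within\<close>)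
    qed (use r in auto)
    then show False using d(3)[of r] r by auto
  qed
  then show ?thesis unfolding G(3) by (intro sum_nonneg) auto
qed

section \<open>Exponential barriers and maximum principles\<close>

lemma has_derivative_exp_height:
  fixes a y :: "'a::euclidean_space"
  assumes "y \<noteq> 0"
  shows "((\<lambda>x. exp (K * (a \<bullet> sgn x))) has_derivative
    (\<lambda>h. ((K * exp (K * (a \<bullet> sgn y))) *\<^sub>R ((1 / norm y) *\<^sub>R a - ((a \<bullet> y) / norm y ^ 3) *\<^sub>R y)) \<bullet> h)) (at y)"
proof -
  have "((\<lambda>x. exp (K * ((a \<bullet> x) / norm x))) has_derivative
    (\<lambda>h. exp (K * ((a \<bullet> y) / norm y)) * (K * (((a \<bullet> h) * norm y - (a \<bullet> y) * (h \<bullet> sgn y)) / (norm y * norm y))))) (at y)"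
    using assms by (auto intro!: derivative_eq_intros has_derivative_norm simp: right_diff_distrib mult_ac)
  moreover have "(a \<bullet> x) / norm x = a \<bullet> sgn x" for x :: 'a
    by (simp add: sgn_div_norm divide_inverse mult.commute)
  moreover have "E * (K * (((a \<bullet> h) * norm y - (a \<bullet> y) * (h \<bullet> sgn y)) / (norm y * norm y)))
      = ((K * E) *\<^sub>R ((1 / norm y) *\<^sub>R a - ((a \<bullet> y) / norm y ^ 3) *\<^sub>R y)) \<bullet> h" for h E
    using assms by (simp add: sgn_div_norm inner_diff_left inner_commute[of h y] field_simps power3_eq_cube)
  ultimately show ?thesis by (simp only:)
qed

text \<open>The height \<open>p = a \<bullet> \<sigma>\<close> has squared gradient
  \<open>a \<bullet> a - p\<^sup>2\<close> and is an eigenfunction with Laplacian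
  \<open>- (DIM - 1) * p\<close>; the formula is the chain rule for \<open>exp (K * p)\<close>. For
  large \<open>K\<close> the gradient term dominates where it stays away from \<open>0\<close>,
  which is what makes these functions useful as barriers.\<close>

lemma has_laplacian_exp_height:
  fixes a \<sigma> :: "'a::euclidean_space"
  assumes n: "norm \<sigma> = 1"
  shows "has_laplacian (\<lambda>x. exp (K * (a \<bullet> sgn x)))
    (exp (K * (a \<bullet> \<sigma>)) * (K\<^sup>2 * (a \<bullet> a - (a \<bullet> \<sigma>)\<^sup>2) - (real DIM('a) - 1) * K * (a \<bullet> \<sigma>))) \<sigma>"
proof -
  define p where "p = a \<bullet> \<sigma>"
  have s0: "\<sigma> \<noteq> 0" "\<sigma> \<bullet> \<sigma> = 1" "sgn \<sigma> = \<sigma>" using n norm_eq_1[of \<sigma>] by (auto simp: sgn_div_norm)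
  define g where "g = a - p *\<^sub>R \<sigma>"
  define H where "H h = (K * exp (K * p)) *\<^sub>R (- (\<sigma> \<bullet> h) *\<^sub>R a - ((a \<bullet> h) - 3 * p * (\<sigma> \<bullet> h)) *\<^sub>R \<sigma> - p *\<^sub>R h)
    + (K * exp (K * p) * K * (g \<bullet> h)) *\<^sub>R g" for h
  have "((\<lambda>y. (1 / norm y) *\<^sub>R a - ((a \<bullet> y) / norm y ^ 3) *\<^sub>R y) has_derivative
      (\<lambda>h. - (\<sigma> \<bullet> h) *\<^sub>R a - ((a \<bullet> h) - 3 * p * (\<sigma> \<bullet> h)) *\<^sub>R \<sigma> - p *\<^sub>R h)) (at \<sigma>)"
    using s0 n
    by (auto intro!: derivative_eq_intros has_derivative_norm simp: p_def inner_commute algebra_simps)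
  from has_derivative_scaleR[OF has_derivative_mult_right[OF has_derivative_exp_height[OF s0(1), of K a], of K] this]
  have "((\<lambda>y. (K * exp (K * (a \<bullet> sgn y))) *\<^sub>R ((1 / norm y) *\<^sub>R a - ((a \<bullet> y) / norm y ^ 3) *\<^sub>R y)) has_derivative H) (at \<sigma>)"
    by (simp add: H_def[abs_def] s0 n p_def[symmetric] g_def[symmetric] mult_ac)
  moreover have "\<forall>\<^sub>F y in nhds \<sigma>. y \<noteq> 0"
    using s0(1) by (intro t1_space_nhds)
  then have "\<forall>\<^sub>F y in nhds \<sigma>. ((\<lambda>x. exp (K * (a \<bullet> sgn x))) has_derivative
    (\<lambda>h. ((K * exp (K * (a \<bullet> sgn y))) *\<^sub>R ((1 / norm y) *\<^sub>R a - ((a \<bullet> y) / norm y ^ 3) *\<^sub>R y)) \<bullet> h)) (at y)"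
    by eventually_elim (rule has_derivative_exp_height)
  moreover have "(\<Sum>b\<in>Basis. H b \<bullet> b) = exp (K * p) * (K\<^sup>2 * (a \<bullet> a - p\<^sup>2) - (real DIM('a) - 1) * K * p)"
  proof -
    have "H b \<bullet> b = (K * exp (K * p)) * (3 * p * ((\<sigma> \<bullet> b) * (\<sigma> \<bullet> b)) - 2 * ((a \<bullet> b) * (\<sigma> \<bullet> b)) - p)
      + K * exp (K * p) * K * ((g \<bullet> b) * (g \<bullet> b))" if "b \<in> Basis" for b
      using that by (simp add: H_def inner_add_left inner_diff_left algebra_simps)
    then have "(\<Sum>b\<in>Basis. H b \<bullet> b) = (\<Sum>b\<in>Basis. (K * exp (K * p)) * (3 * p * ((\<sigma> \<bullet> b) * (\<sigma> \<bullet> b)) - 2 * ((a \<bullet> b) * (\<sigma> \<bullet> b)) - p)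
      + K * exp (K * p) * K * ((g \<bullet> b) * (g \<bullet> b)))" by simp
    also have "\<dots> = (K * exp (K * p)) * (3 * p * (\<sigma> \<bullet> \<sigma>) - 2 * (a \<bullet> \<sigma>) - real DIM('a) * p) + K * exp (K * p) * K * (g \<bullet> g)"
      by (simp only: sum.distrib sum_subtractf sum_distrib_left[symmetric] euclidean_inner[symmetric] sum_constant)
    also have "g \<bullet> g = a \<bullet> a - p\<^sup>2"
      using s0 by (simp add: g_def p_def inner_diff_left inner_diff_right inner_commute power2_eq_square)
    finally show ?thesis by (simp add: s0 p_def[symmetric] algebra_simps power2_eq_square)
  qed
  ultimately show ?thesis unfolding p_def by (intro has_laplacianI) auto
qed

text \<open>Composition with \<open>sgn\<close>, which is continuous off the origin, turns a minimum
  relative to the sphere into a local minimum in the ambient space.\<close>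

lemma sphere_interior_min:
  assumes "open U" "\<sigma> \<in> U" "norm \<sigma> = 1" "\<And>\<tau>. \<tau> \<in> U \<Longrightarrow> norm \<tau> = 1 \<Longrightarrow> f \<sigma> \<le> f \<tau>"
    and "has_laplacian (\<lambda>x. f (sgn x)) L \<sigma>"
  shows "0 \<le> L"
proof (rule has_laplacian_local_min[OF assms(5)])
  have s: "\<sigma> \<noteq> 0" "sgn \<sigma> = \<sigma>" using assms(3) by (auto simp: sgn_div_norm)
  then have "isCont sgn \<sigma>" by (intro isCont_sgn continuous_intros) auto
  moreover have "\<forall>\<^sub>F y in nhds (sgn \<sigma>). y \<in> U"
    using assms(1,2) s by (intro eventually_nhds_in_open) auto
  ultimately have "\<forall>\<^sub>F y in nhds \<sigma>. sgn y \<in> U" by (rule eventually_nhds_compose)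
  moreover have "\<forall>\<^sub>F y in nhds \<sigma>. y \<noteq> 0" using s by (intro t1_space_nhds)
  ultimately show "\<forall>\<^sub>F y in nhds \<sigma>. f (sgn \<sigma>) \<le> f (sgn y)"
    by eventually_elim (use assms(4) s in \<open>simp add: norm_sgn\<close>)
qed

lemma inner_le_one:
  "norm x = 1 \<Longrightarrow> norm y = 1 \<Longrightarrow> \<bar>x \<bullet> y\<bar> \<le> 1"
  using Cauchy_Schwarz_ineq2[of x y] by simp

lemma unit_dist_sq:
  "norm x = 1 \<Longrightarrow> norm y = 1 \<Longrightarrow> (dist x y)\<^sup>2 = 2 - 2 * (x \<bullet> y)"
  by (simp add: dist_norm power2_norm_eq_inner inner_diff_left inner_diff_right inner_commute norm_eq_1)

text \<open>Positivity at the centre spreads over the cap. The comparison function \<open>b\<close>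
  vanishes on the rim and is a strict subsolution outside a small cap around \<open>x0\<close>,
  inside which \<open>w > \<delta>\<close>; hence \<open>w - \<epsilon> * b\<close> has no negative
  minimum.\<close>

lemma cap_positive:
  fixes w :: "'a::euclidean_space \<Rightarrow> real" and \<kappa> :: real
  assumes x0: "norm x0 = 1" and C: "C \<ge> 0" and k: "0 \<le> \<kappa>" "\<kappa> < 1"
  defines "D \<equiv> {\<sigma>. norm \<sigma> = 1 \<and> x0 \<bullet> \<sigma> \<ge> \<kappa>}"
  assumes cont: "continuous_on D w" and nonneg: "\<And>\<sigma>. \<sigma> \<in> D \<Longrightarrow> 0 \<le> w \<sigma>"
    and lap: "\<And>\<sigma>. \<sigma> \<in> D \<Longrightarrow> \<exists>L. has_laplacian (\<lambda>x. w (sgn x)) L \<sigma> \<and> L \<le> C * w \<sigma>"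
    and pos: "w x0 > 0" and y: "norm y = 1" "x0 \<bullet> y > \<kappa>"
  shows "w y > 0"
proof -
  have x0x0: "x0 \<bullet> x0 = 1" using x0 by (simp add: norm_eq_1)
  then have x0D: "x0 \<in> D" using x0 k by (simp add: D_def)
  define \<delta> where "\<delta> = w x0 / 2"
  obtain r0 where r0: "r0 > 0" "\<And>\<tau>. \<tau> \<in> D \<Longrightarrow> dist \<tau> x0 < r0 \<Longrightarrow> dist (w \<tau>) (w x0) < \<delta>"
    using cont x0D pos unfolding continuous_on_iff \<delta>_def by (metis half_gt_zero)
  define r where "r = min r0 1"
  \<comment> \<open>For unit vectors, a distance below \<open>r\<close> means an inner product above
    \<open>1 - r\<^sup>2 / 2\<close>.\<close>
  define \<rho> where "\<rho> = 1 - r\<^sup>2 / 2"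
  have "r \<le> 1" "r > 0" using r0 by (auto simp: r_def)
  then have "r\<^sup>2 \<le> 1" "r\<^sup>2 > 0" by (auto simp: power_le_one)
  then have rho: "0 < \<rho>" "\<rho> < 1" by (auto simp: \<rho>_def)
  have near: "w \<tau> > \<delta>" if "\<tau> \<in> D" "x0 \<bullet> \<tau> > \<rho>" for \<tau>
  proof -
    have "(dist x0 \<tau>)\<^sup>2 < r\<^sup>2"
      using unit_dist_sq[OF x0, of \<tau>] that by (simp add: D_def \<rho>_def)
    then have "dist \<tau> x0 < r0"
      using power_less_imp_less_base[of "dist x0 \<tau>" 2 r] \<open>r > 0\<close> by (simp add: dist_commute r_def)
    then have "\<bar>w \<tau> - w x0\<bar> < \<delta>" using r0(2)[OF that(1)] by (simp add: dist_real_def)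
    then show ?thesis unfolding \<delta>_def by linarith
  qed
  define N where "N = real DIM('a)"
  have N: "N \<ge> 1" using DIM_positive[where 'a='a] by (simp add: N_def)
  have "\<rho>\<^sup>2 < 1" using rho by (simp add: power_less_one_iff)
  \<comment> \<open>Chosen to give
    \<open>K\<^sup>2 * (1 - \<rho>\<^sup>2) - (N - 1) * K \<ge> C + 1\<close>, a lower bound for the
    factor of the exponential in its Laplacian at heights between \<open>\<kappa>\<close> and
    \<open>\<rho>\<close>.\<close>
  define K where "K = max 1 ((N + C) / (1 - \<rho>\<^sup>2))"
  have K: "K \<ge> 1" by (simp add: K_def)
  have "K * (1 - \<rho>\<^sup>2) \<ge> N + C" using \<open>\<rho>\<^sup>2 < 1\<close> by (simp add: K_def pos_divide_le_eq[symmetric])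
  then have "K * (K * (1 - \<rho>\<^sup>2)) \<ge> K * (N + C)" using K by (intro mult_left_mono) auto
  then have K2: "K\<^sup>2 * (1 - \<rho>\<^sup>2) - (N - 1) * K \<ge> K * (C + 1)"
    by (simp add: power2_eq_square algebra_simps)
  have "1 * (C + 1) \<le> K * (C + 1)" using K C by (intro mult_right_mono) auto
  then have K3: "K\<^sup>2 * (1 - \<rho>\<^sup>2) - (N - 1) * K \<ge> C + 1" using order_trans[OF _ K2] by simp
  \<comment> \<open>On the cap \<open>b\<close> is at most \<open>exp K\<close>, so
    \<open>\<epsilon> * b\<close> never exceeds \<open>\<delta>\<close> and stays below
    \<open>w\<close> near \<open>x0\<close>.\<close>
  define \<epsilon> where "\<epsilon> = \<delta> / exp K"
  have eps: "\<epsilon> > 0" "\<delta> = \<epsilon> * exp K" using pos by (auto simp: \<epsilon>_def \<delta>_def)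
  define b where "b \<tau> = exp (K * (x0 \<bullet> \<tau>)) - exp (K * \<kappa>)" for \<tau>
  define \<Phi> where "\<Phi> \<tau> = w \<tau> + (- \<epsilon>) * exp (K * (x0 \<bullet> \<tau>)) + \<epsilon> * exp (K * \<kappa>)" for \<tau>
  have Phi: "\<Phi> \<tau> = w \<tau> - \<epsilon> * b \<tau>" for \<tau> by (simp add: \<Phi>_def b_def algebra_simps)
  have "compact D"
  proof -
    have "D = sphere 0 1 \<inter> {\<sigma>. x0 \<bullet> \<sigma> \<ge> \<kappa>}" by (auto simp: D_def)
    then show ?thesis by (simp add: compact_Int_closed closed_halfspace_ge)
  qed
  moreover have "continuous_on D \<Phi>" unfolding \<Phi>_def by (intro continuous_intros cont)
  ultimately obtain s where s: "s \<in> D" "\<And>\<tau>. \<tau> \<in> D \<Longrightarrow> \<Phi> s \<le> \<Phi> \<tau>"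
    using continuous_attains_inf[of D \<Phi>] x0D by blast
  have "0 \<le> \<Phi> s"
  proof (rule ccontr)
    assume neg: "\<not> 0 \<le> \<Phi> s"
    define p where "p = x0 \<bullet> s"
    have ns: "norm s = 1" and pk: "p \<ge> \<kappa>" using s(1) by (auto simp: D_def p_def)
    have "\<epsilon> * b s > 0" using neg nonneg[OF s(1)] Phi[of s] by linarith
    then have "b s > 0" using eps by (simp add: zero_less_mult_iff)
    then have "p > \<kappa>" using K by (simp add: b_def p_def)
    have "p \<le> 1" using inner_le_one[OF x0 ns] by (simp add: p_def)
    have "p \<le> \<rho>"
    proof (rule ccontr)
      assume "\<not> p \<le> \<rho>"
      then have "w s > \<delta>" using near[OF s(1)] by (simp add: p_def)
      moreover have "b s \<le> exp K" using \<open>p \<le> 1\<close> K by (simp add: b_def p_def add_increasing2 diff_le_eq)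
      then have "\<epsilon> * b s \<le> \<delta>" using eps by simp
      ultimately show False using neg Phi[of s] by linarith
    qed
    obtain L where L: "has_laplacian (\<lambda>x. w (sgn x)) L s" "L \<le> C * w s"
      using lap[OF s(1)] by blast
    define E where "E = exp (K * p)"
    define Q where "Q = E * (K\<^sup>2 * (x0 \<bullet> x0 - p\<^sup>2) - (N - 1) * K * p)"
    have "has_laplacian (\<lambda>x. \<Phi> (sgn x)) (L + (- \<epsilon>) * Q + 0) s"
      unfolding \<Phi>_def Q_def E_def p_def N_def
      by (intro has_laplacian_add has_laplacian_cmult has_laplacian_const L(1) has_laplacian_exp_height ns)
    then have "0 \<le> L + (- \<epsilon>) * Q + 0"
      by (rule sphere_interior_min[of "{\<tau>. x0 \<bullet> \<tau> > \<kappa>}", rotated 4])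
        (use \<open>p > \<kappa>\<close> ns s(2) in \<open>auto simp: open_halfspace_gt p_def D_def\<close>)
    moreover have "E * (C + 1) \<le> Q"
      unfolding Q_def x0x0
    proof (rule mult_left_mono)
      have "p\<^sup>2 \<le> \<rho>\<^sup>2" using \<open>p \<le> \<rho>\<close> pk k by (intro power_mono) auto
      then have "K\<^sup>2 * (1 - \<rho>\<^sup>2) \<le> K\<^sup>2 * (1 - p\<^sup>2)" by (intro mult_left_mono) auto
      moreover have "(N - 1) * K * p \<le> (N - 1) * K" using N K \<open>p \<le> 1\<close> by (intro mult_left_le) auto
      ultimately show "C + 1 \<le> K\<^sup>2 * (1 - p\<^sup>2) - (N - 1) * K * p" using K3 by linarith
    qed (simp add: E_def)
    then have "\<epsilon> * (E * (C + 1)) \<le> \<epsilon> * Q" using eps by simp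
    moreover have "\<epsilon> * (E * (C + 1)) = C * (\<epsilon> * E) + \<epsilon> * E" by (simp add: algebra_simps)
    moreover have "\<epsilon> * E > 0" using eps by (simp add: E_def)
    ultimately have "0 < C * w s - C * (\<epsilon> * E)" using L(2) by linarith
    also have "\<dots> = C * (w s - \<epsilon> * E)" by (simp add: algebra_simps)
    also have "\<dots> \<le> 0"
    proof (rule mult_nonneg_nonpos[OF C])
      have "\<epsilon> * b s \<le> \<epsilon> * E" using eps by (simp add: b_def E_def p_def)
      then show "w s - \<epsilon> * E \<le> 0" using neg Phi[of s] by linarith
    qed
    finally show False by simp
  qed
  moreover have "y \<in> D" using y by (simp add: D_def)
  ultimately have "w y \<ge> \<epsilon> * b y" using s(2)[of y] Phi[of y] by linarith
  moreover have "b y > 0" using y K by (simp add: b_def)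
  then have "\<epsilon> * b y > 0" using eps by simp
  ultimately show ?thesis by linarith
qed

text \<open>The positivity set is relatively open by continuity and relatively closed by
  \<open>cap_positive\<close>: a zero too near a point of positivity would lie inside an admissible
  cap around that point.\<close>

lemma strong_maximum_principle:
  fixes w :: "'a::euclidean_space \<Rightarrow> real"
  assumes op: "open V" and conn: "connected (sphere 0 1 \<inter> V)" and C: "C \<ge> 0"
    and cont: "continuous_on (sphere 0 1 \<inter> V) w"
    and nonneg: "\<And>\<sigma>. \<sigma> \<in> sphere 0 1 \<inter> V \<Longrightarrow> 0 \<le> w \<sigma>"
    and lap: "\<And>\<sigma>. \<sigma> \<in> sphere 0 1 \<inter> V \<Longrightarrow> \<exists>L. has_laplacian (\<lambda>x. w (sgn x)) L \<sigma> \<and> L \<le> C * w \<sigma>"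
    and x: "x \<in> sphere 0 1 \<inter> V" "w x > 0" and y: "y \<in> sphere 0 1 \<inter> V"
  shows "w y > 0"
proof -
  define U where "U = sphere 0 1 \<inter> V"
  define Z where "Z = U \<inter> w -` {0<..}"
  have "openin (top_of_set U) Z"
    unfolding Z_def U_def by (rule continuous_openin_preimage_gen[OF cont]) simp
  moreover have "openin (top_of_set U) (U - Z)"
    unfolding openin_euclidean_subtopology_iff
  proof (intro conjI ballI)
    fix z assume z: "z \<in> U - Z"
    then have nz: "norm z = 1" "w z = 0" using nonneg[of z] by (auto simp: U_def Z_def)
    obtain r0 where r0: "r0 > 0" "ball z r0 \<subseteq> V" using op z by (auto simp: U_def open_contains_ball)
    define r where "r = min r0 1"
    have r: "0 < r" "r \<le> 1" "ball z r \<subseteq> V" using r0 by (auto simp: r_def)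
    \<comment> \<open>\<open>\<kappa>\<close> describes caps of radius \<open>r / 2\<close>. Around
      any \<open>t\<close> with \<open>dist t z < r / 4\<close> such a cap contains \<open>z\<close>
      and stays inside \<open>ball z r\<close>.\<close>
    define \<kappa> where "\<kappa> = 1 - (r / 2)\<^sup>2 / 2"
    have "(r / 2)\<^sup>2 \<le> 1" using r by (intro power_le_one) auto
    then have k: "0 \<le> \<kappa>" "\<kappa> < 1" using r by (auto simp: \<kappa>_def)
    have "t \<in> U - Z" if t: "t \<in> U" "dist t z < r / 4" for t
    proof (rule ccontr)
      assume "t \<notin> U - Z"
      then have wt: "w t > 0" and nt: "norm t = 1" using t by (auto simp: Z_def U_def)
      have cap: "s \<in> U" if "norm s = 1" "t \<bullet> s \<ge> \<kappa>" for s
      proof -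
        have "(dist t s)\<^sup>2 \<le> (r / 2)\<^sup>2"
          using unit_dist_sq[OF nt that(1)] that(2) by (simp add: \<kappa>_def)
        then have "dist t s \<le> r / 2" by (rule power2_le_imp_le) (use r in auto)
        then have "dist z s < r" using dist_triangle[of z s t] t r by (simp add: dist_commute)
        then show ?thesis using r(3) that by (auto simp: U_def)
      qed
      have "(dist t z)\<^sup>2 < (r / 2)\<^sup>2" using t r by (intro power_strict_mono) auto
      then have tz: "t \<bullet> z > \<kappa>" using unit_dist_sq[OF nt nz(1)] by (simp add: \<kappa>_def)
      have "w z > 0"
      proof (rule cap_positive[where w = w, OF nt C k _ _ _ wt nz(1) tz])
        show "continuous_on {\<sigma>. norm \<sigma> = 1 \<and> \<kappa> \<le> t \<bullet> \<sigma>} w"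
          by (rule continuous_on_subset[OF cont]) (use cap in \<open>auto simp: U_def\<close>)
        fix s assume "s \<in> {\<sigma>. norm \<sigma> = 1 \<and> \<kappa> \<le> t \<bullet> \<sigma>}"
        then have s: "s \<in> sphere 0 1 \<inter> V" using cap[of s] by (simp add: U_def)
        show "0 \<le> w s" "\<exists>L. has_laplacian (\<lambda>x. w (sgn x)) L s \<and> L \<le> C * w s"
          by (rule nonneg[OF s], rule lap[OF s])
      qed
      then show False using nz by simp
    qed
    then show "\<exists>e>0. \<forall>t\<in>U. dist t z < e \<longrightarrow> t \<in> U - Z"
      using r by (metis divide_pos_pos zero_less_numeral)
  qed auto
  then have "closedin (top_of_set U) Z"
    unfolding closedin_def topspace_euclidean_subtopology by (simp add: Z_def)
  ultimately have "Z = {} \<or> Z = U"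
    using connected_clopen[THEN iffD1, OF conn[folded U_def]] by (iprover)
  moreover have "x \<in> Z" using x by (simp add: Z_def U_def)
  ultimately have "y \<in> Z" using y U_def by blast
  then show ?thesis by (simp add: Z_def)
qed

text \<open>
  The barrier \<open>4 - exp (- K (a \<bullet> \<sigma>)) - exp (- K (b \<bullet> \<sigma>))\<close> is strictly superharmonic, strongly so near the two
  sides, which makes the maximum principle hold there although the zeroth order term has the wrong sign.
\<close>

lemma lune_maximum_principle:
  fixes w :: "'a::euclidean_space \<Rightarrow> real"
  assumes ab: "norm a = 1" "norm b = 1" and C: "C \<ge> 0"
  defines "D \<equiv> {\<sigma>. norm \<sigma> = 1 \<and> a \<bullet> \<sigma> \<ge> 0 \<and> b \<bullet> \<sigma> \<ge> 0}" and "\<epsilon> \<equiv> 1 / (8 * (C + 1))"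
  assumes cont: "continuous_on D w"
    and bd: "\<And>\<sigma>. \<sigma> \<in> D \<Longrightarrow> a \<bullet> \<sigma> = 0 \<or> b \<bullet> \<sigma> = 0 \<Longrightarrow> 0 \<le> w \<sigma>"
    and inner: "\<And>\<sigma>. \<sigma> \<in> D \<Longrightarrow> a \<bullet> \<sigma> \<ge> \<epsilon> \<Longrightarrow> b \<bullet> \<sigma> \<ge> \<epsilon> \<Longrightarrow> 0 \<le> w \<sigma>"
    and lap: "\<And>\<sigma>. \<sigma> \<in> D \<Longrightarrow> a \<bullet> \<sigma> > 0 \<Longrightarrow> b \<bullet> \<sigma> > 0 \<Longrightarrow> w \<sigma> < 0 \<Longrightarrow>
      \<exists>L. has_laplacian (\<lambda>x. w (sgn x)) L \<sigma> \<and> L \<le> - C * w \<sigma>"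
    and y: "y \<in> D"
  shows "0 \<le> w y"
proof -
  \<comment> \<open>At a height \<open>t < \<epsilon> = 1 / (2 * K)\<close> over a side, both
    \<open>exp (- K * t)\<close> and \<open>1 - t\<^sup>2\<close> are at least \<open>1 / 2\<close>.
    The Laplacian of the barrier is then at most
    \<open>- K\<^sup>2 / 4 = - 4 * (C + 1)\<^sup>2\<close>, hence at most
    \<open>- (4 * C + 4)\<close>, which beats \<open>C * g \<le> 4 * C\<close>.\<close>
  define K where "K = 4 * (C + 1)"
  have K: "K \<ge> 4" "\<epsilon> = 1 / (2 * K)" using C by (auto simp: K_def \<epsilon>_def)
  define g where "g \<tau> = 4 + (- 1) * exp (- K * (a \<bullet> \<tau>)) + (- 1) * exp (- K * (b \<bullet> \<tau>))" for \<tau>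
  have g: "2 \<le> g \<tau>" "g \<tau> \<le> 4" if "\<tau> \<in> D" for \<tau>
  proof -
    have "exp (- K * (a \<bullet> \<tau>)) \<le> 1" "exp (- K * (b \<bullet> \<tau>)) \<le> 1"
      using that K by (auto simp: D_def)
    then show "2 \<le> g \<tau>" unfolding g_def by linarith
    show "g \<tau> \<le> 4" unfolding g_def using exp_ge_zero[of "- K * (a \<bullet> \<tau>)"] exp_ge_zero[of "- K * (b \<bullet> \<tau>)"] by linarith
  qed
  have "compact D"
  proof -
    have "D = sphere 0 1 \<inter> ({\<sigma>. a \<bullet> \<sigma> \<ge> 0} \<inter> {\<sigma>. b \<bullet> \<sigma> \<ge> 0})" by (auto simp: D_def)
    then show ?thesis by (simp add: compact_Int_closed closed_halfspace_ge closed_Int)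
  qed
  moreover have "continuous_on D g" unfolding g_def by (intro continuous_intros)
  then have "continuous_on D (\<lambda>\<tau>. w \<tau> / g \<tau>)"
    by (intro continuous_on_divide cont) (use g(1) in fastforce)+
  ultimately obtain s where s: "s \<in> D" "\<And>\<tau>. \<tau> \<in> D \<Longrightarrow> w s / g s \<le> w \<tau> / g \<tau>"
    using continuous_attains_inf[of D "\<lambda>\<tau>. w \<tau> / g \<tau>"] y by blast
  have "0 \<le> w s / g s"
  proof (rule ccontr)
    assume neg: "\<not> 0 \<le> w s / g s"
    \<comment> \<open>If the least value of the quotient is \<open>- m < 0\<close>, then
      \<open>w + m * g\<close> is nonnegative and touches \<open>0\<close> at the interior point
      \<open>s\<close>, where its Laplacian turns out to be negative.\<close>
    define m where "m = - (w s / g s)"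
    have m: "m > 0" using neg by (simp add: m_def)
    have ws: "w s = - m * g s" using g[OF s(1)] by (simp add: m_def)
    then have ws0: "w s < 0" using m g[OF s(1)] by (simp add: mult_pos_pos)
    have ns: "norm s = 1" using s(1) by (simp add: D_def)
    define \<Phi> where "\<Phi> \<tau> = w \<tau> + m * g \<tau>" for \<tau>
    have Phi: "\<Phi> s \<le> \<Phi> \<tau>" if "\<tau> \<in> D" for \<tau>
    proof -
      have "- m * g \<tau> \<le> w \<tau>" using s(2)[OF that] g[OF that] by (simp add: m_def pos_le_divide_eq)
      then show ?thesis using ws by (simp add: \<Phi>_def)
    qed
    define p r where "p = a \<bullet> s" and "r = b \<bullet> s"
    have pr: "p > 0" "r > 0" using bd[OF s(1)] ws0 s(1) by (force simp: p_def r_def D_def less_le)+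
    obtain L where L: "has_laplacian (\<lambda>x. w (sgn x)) L s" "L \<le> - C * w s"
      using lap[OF s(1)] pr ws0 by (auto simp: p_def r_def)
    define Q where "Q p = exp (- K * p) * ((- K)\<^sup>2 * (1 - p\<^sup>2) - (real DIM('a) - 1) * (- K) * p)" for p
    have aa: "a \<bullet> a = 1" "b \<bullet> b = 1" using ab by (simp_all add: norm_eq_1)
    have "has_laplacian (\<lambda>x. \<Phi> (sgn x)) (L + m * (0 + (- 1) * Q p + (- 1) * Q r)) s"
      unfolding \<Phi>_def g_def Q_def p_def r_def
      using has_laplacian_exp_height[OF ns, of "- K" a] has_laplacian_exp_height[OF ns, of "- K" b]
      by (intro has_laplacian_add has_laplacian_cmult has_laplacian_const L(1)) (simp_all add: aa)
    then have min: "0 \<le> L + m * (0 + (- 1) * Q p + (- 1) * Q r)"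
      by (rule sphere_interior_min[of "{\<tau>. a \<bullet> \<tau> > 0} \<inter> {\<tau>. b \<bullet> \<tau> > 0}", rotated 4])
        (use pr ns Phi in \<open>auto simp: open_halfspace_gt p_def r_def D_def intro!: open_Int\<close>)
    have le1: "p \<le> 1" "r \<le> 1" using inner_le_one[OF ab(1) ns] inner_le_one[OF ab(2) ns] by (auto simp: p_def r_def)
    have N: "real DIM('a) - 1 \<ge> 0" using DIM_positive[where 'a='a] by simp
    have Qge: "Q t \<ge> exp (- K * t) * (K\<^sup>2 * (1 - t\<^sup>2))" if "t > 0" for t
      unfolding Q_def using N K that by (intro mult_left_mono) auto
    have Q0: "Q t \<ge> 0" if "t > 0" "t \<le> 1" for t
    proof -
      have "t\<^sup>2 \<le> 1" using that by (simp add: power_le_one)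
      then have "0 \<le> exp (- K * t) * (K\<^sup>2 * (1 - t\<^sup>2))" by simp
      then show ?thesis using Qge[OF that(1)] by linarith
    qed
    have Q1: "Q t \<ge> 4 * C + 4" if "t > 0" "t < \<epsilon>" for t
    proof -
      have Kt: "K * t < 1 / 2" using that K by (simp add: field_simps)
      have "exp (- K * t) \<ge> 1 / 2" using exp_ge_add_one_self[of "- K * t"] Kt by simp
      moreover have "4 * t \<le> K * t" using K that by (intro mult_right_mono) auto
      then have "t < 1 / 8" using Kt by linarith
      then have "t\<^sup>2 \<le> (1 / 8)\<^sup>2" using that by (intro power_mono) auto
      then have "1 - t\<^sup>2 \<ge> 1 / 2" by (simp add: power2_eq_square)
      ultimately have "exp (- K * t) * (K\<^sup>2 * (1 - t\<^sup>2)) \<ge> 1 / 2 * (K\<^sup>2 * (1 / 2))"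
        by (intro mult_mono) auto
      moreover have "1 / 2 * (K\<^sup>2 * (1 / 2)) = 4 * (C + 1) * (C + 1)" by (simp add: K_def power2_eq_square)
      moreover have "4 * (C + 1) * (C + 1) \<ge> 4 * (C + 1) * 1" using C by (intro mult_left_mono) auto
      ultimately have "4 * (C + 1) * 1 \<le> Q t" using Qge[OF that(1)] by (metis order_trans)
      then show ?thesis by simp
    qed
    have "p < \<epsilon> \<or> r < \<epsilon>" using inner[OF s(1)] ws0 by (force simp: p_def r_def)
    then have "Q p + Q r \<ge> 4 * C + 4"
      using Q0[of p] Q0[of r] Q1[of p] Q1[of r] pr le1 by linarith
    then have "m * (Q p + Q r) \<ge> m * (4 * C + 4)" using m by simp
    moreover have "- C * w s \<le> m * (4 * C)"
    proof -
      have "- C * w s = m * (C * g s)" by (simp add: ws)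
      also have "\<dots> \<le> m * (C * 4)" using m C g(2)[OF s(1)] by (intro mult_left_mono) auto
      finally show ?thesis by (simp add: mult_ac)
    qed
    moreover have "m * (0 + (- 1) * Q p + (- 1) * Q r) = - (m * (Q p + Q r))" by (simp add: algebra_simps)
    moreover have "m * (4 * C + 4) = m * (4 * C) + 4 * m" by (simp add: algebra_simps)
    ultimately show False using min L(2) m by linarith
  qed
  then have "0 \<le> w y / g y" using s(2)[OF y] by linarith
  then show ?thesis using g[OF y] by (simp add: zero_le_divide_iff)
qed

section \<open>Axial symmetry of positive solutions\<close>

lemma has_derivative_sgn:
  fixes y :: "'a::euclidean_space"
  assumes "y \<noteq> 0"
  shows "(sgn has_derivative (\<lambda>h. (1 / norm y) *\<^sub>R (h - (sgn y \<bullet> h) *\<^sub>R sgn y))) (at y)"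
proof -
  have "((\<lambda>x. (1 / norm x) *\<^sub>R x) has_derivative
      (\<lambda>h. (1 / norm y) *\<^sub>R h + (- (h \<bullet> sgn y) / (norm y * norm y)) *\<^sub>R y)) (at y)"
    using assms by (auto intro!: derivative_eq_intros has_derivative_norm simp: divide_inverse)
  moreover have "(1 / norm x) *\<^sub>R x = sgn x" for x :: 'a by (simp add: sgn_div_norm divide_inverse)
  moreover have "(1 / norm y) *\<^sub>R h + (- (h \<bullet> sgn y) / (norm y * norm y)) *\<^sub>R y
      = (1 / norm y) *\<^sub>R (h - (sgn y \<bullet> h) *\<^sub>R sgn y)" for h
    using assms by (simp add: sgn_div_norm inner_commute scaleR_diff_right divide_inverse mult_ac)
  ultimately show ?thesis by (simp only:)
qed

lemma sgn_upper_hemisphere: "0 < y $ k \<Longrightarrow> sgn y \<in> upper_hemisphere k"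
  by (cases "y = 0") (auto simp: upper_hemisphere_def sgn_div_norm)

lemma upper_hemisphere_subset: "upper_hemisphere k \<subseteq> closure (upper_hemisphere k)"
  by (rule closure_subset)

text \<open>Eliminates the definite description behind the gradient and the chosen derivative behind
  the divergence; afterwards the equation is a statement about the trace of
  \<open>A\<close>.\<close>

lemma positive_solutionD:
  fixes v :: "real ^ 'n \<Rightarrow> real"
  assumes "positive_solution k lam q v"
  defines "M \<equiv> closure (upper_hemisphere k)"
  obtains g :: "real ^ 'n \<Rightarrow> real ^ 'n" and A :: "real ^ 'n \<Rightarrow> real ^ 'n \<Rightarrow> real ^ 'n" where
    "\<And>\<sigma>. \<sigma> \<in> M \<Longrightarrow> g \<sigma> \<bullet> \<sigma> = 0" "\<And>\<sigma>. \<sigma> \<in> M \<Longrightarrow> (v has_derivative (\<lambda>h. g \<sigma> \<bullet> h)) (at \<sigma> within M)"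
    "\<And>\<sigma>. \<sigma> \<in> M \<Longrightarrow> (g has_derivative A \<sigma>) (at \<sigma> within M)"
    "\<And>\<sigma>. \<sigma> \<in> upper_hemisphere k \<Longrightarrow>
      (\<Sum>b\<in>Basis. A \<sigma> (tangent_proj \<sigma> b) \<bullet> b) = - (lam * v \<sigma> + v \<sigma> powr q)"
proof -
  define g where "g = sphere_grad M v"
  have g: "has_sphere_gradient M v (g \<sigma>) \<sigma>" if "\<sigma> \<in> M" for \<sigma>
    using assms that sphere_grad_eqI[of \<sigma> k v]
    unfolding positive_solution_def C2_on_sphere_subset_def g_def M_def by metis
  obtain A :: "real ^ 'n \<Rightarrow> (real ^ 'n) \<Rightarrow>\<^sub>L (real ^ 'n)"
    where A: "\<And>\<sigma>. \<sigma> \<in> M \<Longrightarrow> (g has_derivative blinfun_apply (A \<sigma>)) (at \<sigma> within M)"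
    using assms unfolding positive_solution_def C2_on_sphere_subset_def g_def M_def by blast
  show ?thesis
  proof (rule that[of g "\<lambda>\<sigma>. blinfun_apply (A \<sigma>)"])
    fix \<sigma> assume s: "\<sigma> \<in> upper_hemisphere k"
    then have "\<sigma> \<in> M" using upper_hemisphere_subset M_def by blast
    then have "laplace_beltrami M v \<sigma> = (\<Sum>b\<in>Basis. A \<sigma> (tangent_proj \<sigma> b) \<bullet> b)"
      unfolding laplace_beltrami_def g_def[symmetric] M_def
      using A[OF \<open>\<sigma> \<in> M\<close>] \<open>\<sigma> \<in> M\<close> unfolding M_def g_def by (intro sphere_div_eqI)
    moreover have "- laplace_beltrami M v \<sigma> = lam * v \<sigma> + v \<sigma> powr q"
      using assms s unfolding positive_solution_def M_def by blast
    ultimately show "(\<Sum>b\<in>Basis. A \<sigma> (tangent_proj \<sigma> b) \<bullet> b) = - (lam * v \<sigma> + v \<sigma> powr q)"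
      by linarith
  qed (use g A in \<open>auto simp: has_sphere_gradient_def\<close>)
qed

lemma positive_solution_continuous:
  assumes "positive_solution k lam q v"
  shows "continuous_on (closure (upper_hemisphere k)) v"
proof -
  obtain g A where "\<And>\<sigma>. \<sigma> \<in> closure (upper_hemisphere k) \<Longrightarrow>
      (v has_derivative (\<lambda>h. g \<sigma> \<bullet> h)) (at \<sigma> within closure (upper_hemisphere k))"
    by (rule positive_solutionD[OF assms]) blast
  then show ?thesis by (intro has_derivative_continuous_on)
qed

text \<open>The ambient gradient of \<open>v (sgn x)\<close> at \<open>y\<close> is
  \<open>g (sgn y)\<close> divided by \<open>norm y\<close>. Besides the spherical divergence, its
  derivative at \<open>\<sigma>\<close> contributes only the term from \<open>1 / norm y\<close>,
  with trace \<open>- (\<sigma> \<bullet> g \<sigma>) = 0\<close> because \<open>g\<close> is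
  tangential.\<close>

lemma positive_solution_laplacian:
  fixes v :: "real ^ 'n \<Rightarrow> real"
  assumes v: "positive_solution k lam q v" and s: "\<sigma> \<in> upper_hemisphere k"
  shows "has_laplacian (\<lambda>x. v (sgn x)) (- (lam * v \<sigma> + v \<sigma> powr q)) \<sigma>"
proof -
  let ?M = "closure (upper_hemisphere k)"
  obtain g A where gA: "\<And>\<sigma>. \<sigma> \<in> ?M \<Longrightarrow> g \<sigma> \<bullet> \<sigma> = 0"
    "\<And>\<sigma>. \<sigma> \<in> ?M \<Longrightarrow> (v has_derivative (\<lambda>h. g \<sigma> \<bullet> h)) (at \<sigma> within ?M)"
    "\<And>\<sigma>. \<sigma> \<in> ?M \<Longrightarrow> (g has_derivative A \<sigma>) (at \<sigma> within ?M)"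
    "\<And>\<sigma>. \<sigma> \<in> upper_hemisphere k \<Longrightarrow>
      (\<Sum>b\<in>Basis. A \<sigma> (tangent_proj \<sigma> b) \<bullet> b) = - (lam * v \<sigma> + v \<sigma> powr q)"
    by (rule positive_solutionD[OF v]) blast
  define U where "U = {y :: real ^ 'n. 0 < y $ k}"
  have oU: "open U" unfolding U_def by (intro open_Collect_less continuous_intros)
  have ns: "norm \<sigma> = 1" "\<sigma> \<in> U" "sgn \<sigma> = \<sigma>" "\<sigma> \<noteq> 0" "\<sigma> \<in> ?M"
    using s upper_hemisphere_subset by (auto simp: upper_hemisphere_def U_def sgn_div_norm)
  have U: "y \<noteq> 0" "sgn y \<in> ?M" if "y \<in> U" for y
    using that sgn_upper_hemisphere[of y k] upper_hemisphere_subset by (auto simp: U_def)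
  have compose: "((\<lambda>x. f (sgn x)) has_derivative (\<lambda>h. f' ((1 / norm y) *\<^sub>R (h - (sgn y \<bullet> h) *\<^sub>R sgn y)))) (at y)"
    if "y \<in> U" "(f has_derivative f') (at (sgn y) within ?M)"
    for y f' and f :: "real ^ 'n \<Rightarrow> 'b::real_normed_vector"
  proof -
    have "(f has_derivative f') (at (sgn y) within sgn ` U)"
      by (rule has_derivative_subset[OF that(2)]) (use U in auto)
    moreover have "(sgn has_derivative (\<lambda>h. (1 / norm y) *\<^sub>R (h - (sgn y \<bullet> h) *\<^sub>R sgn y))) (at y within U)"
      by (rule has_derivative_at_withinI[OF has_derivative_sgn]) (use U that in auto)
    ultimately show ?thesis
      using has_derivative_in_compose[of sgn _ y U f f'] at_within_open[OF that(1) oU] by (simp only:)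
  qed
  show ?thesis
  proof (rule has_laplacianI)
    show "\<forall>\<^sub>F y in nhds \<sigma>. ((\<lambda>x. v (sgn x)) has_derivative (\<lambda>h. ((1 / norm y) *\<^sub>R g (sgn y)) \<bullet> h)) (at y)"
      using eventually_nhds_in_open[OF oU ns(2)]
    proof eventually_elim
      case (elim y)
      show ?case
        using compose[OF elim gA(2)[OF U(2)[OF elim]]] gA(1)[OF U(2)[OF elim]]
        by (simp add: inner_diff_right)
    qed
    have "((\<lambda>y. 1 / norm y) has_derivative (\<lambda>h. - (\<sigma> \<bullet> h))) (at \<sigma>)"
      using ns by (auto intro!: derivative_eq_intros has_derivative_norm simp: inner_commute)
    from has_derivative_scaleR[OF this compose[OF ns(2), of g "A \<sigma>"]]
    show "((\<lambda>y. (1 / norm y) *\<^sub>R g (sgn y)) has_derivative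
        (\<lambda>h. A \<sigma> (tangent_proj \<sigma> h) - (\<sigma> \<bullet> h) *\<^sub>R g \<sigma>)) (at \<sigma>)"
      using ns gA(3)[of \<sigma>] by (simp add: tangent_proj_def inner_commute)
    have "(\<Sum>b\<in>Basis. (A \<sigma> (tangent_proj \<sigma> b) - (\<sigma> \<bullet> b) *\<^sub>R g \<sigma>) \<bullet> b)
        = (\<Sum>b\<in>Basis. A \<sigma> (tangent_proj \<sigma> b) \<bullet> b) - \<sigma> \<bullet> g \<sigma>"
      unfolding euclidean_inner[of \<sigma> "g \<sigma>"] by (simp add: inner_diff_left sum_subtractf)
    then show "- (lam * v \<sigma> + v \<sigma> powr q) = (\<Sum>b\<in>Basis. (A \<sigma> (tangent_proj \<sigma> b) - (\<sigma> \<bullet> b) *\<^sub>R g \<sigma>) \<bullet> b)"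
      using gA(4)[OF s] gA(1)[OF ns(5)] by (simp add: inner_commute)
  qed
qed

lemma sgn_reflection:
  fixes b :: "'a::euclidean_space"
  assumes "norm b = 1" and S_def: "S = (\<lambda>y. y - (2 * (y \<bullet> b)) *\<^sub>R b)"
  shows "norm (S y) = norm y" "sgn (S y) = S (sgn y)" "S (S y) = y"
proof -
  have bb: "b \<bullet> b = 1" using assms by (simp add: norm_eq_1)
  have "S y \<bullet> S y = y \<bullet> y"
    by (simp add: S_def inner_diff_left inner_diff_right bb inner_commute[of b y])
  then show n: "norm (S y) = norm y" by (simp add: norm_eq_sqrt_inner)
  show "sgn (S y) = S (sgn y)"
    unfolding sgn_div_norm n by (simp add: S_def scaleR_diff_right)
  show "S (S y) = y" by (simp add: S_def inner_diff_left bb)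
qed

section \<open>Moving planes in a fixed horizontal direction\<close>

context
  fixes k :: "'n::finite" and lam q :: real and v :: "real ^ 'n \<Rightarrow> real" and e :: "real ^ 'n"
  assumes v: "positive_solution k lam q v" and q: "q > 1"
    and e: "norm e = 1" "e $ k = 0"
begin

text \<open>
  At \<open>\<phi> = 0\<close> the lune degenerates to the boundary \<open>\<sigma> $ k = 0\<close>; at \<open>\<phi> = pi/2\<close> it is half of the hemisphere.
\<close>

definition plane_normal :: "real \<Rightarrow> real ^ 'n" where
  "plane_normal \<phi> = (- cos \<phi>) *\<^sub>R axis k 1 - sin \<phi> *\<^sub>R e"

definition reflect :: "real \<Rightarrow> real ^ 'n \<Rightarrow> real ^ 'n" where
  "reflect \<phi> = (\<lambda>y. y - (2 * (y \<bullet> plane_normal \<phi>)) *\<^sub>R plane_normal \<phi>)"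

definition reflection_gap :: "real \<Rightarrow> real ^ 'n \<Rightarrow> real" where
  "reflection_gap \<phi> \<sigma> = v (reflect \<phi> \<sigma>) - v \<sigma>"

text \<open>For an angle in \<open>(0, pi/2]\<close> this is the wedge of that opening angle between
  the half of the equator with \<open>e \<bullet> \<sigma> \<le> 0\<close> and the mirror.\<close>

definition lune :: "real \<Rightarrow> (real ^ 'n) set" where
  "lune \<phi> = {\<sigma>. norm \<sigma> = 1 \<and> axis k 1 \<bullet> \<sigma> \<ge> 0 \<and> plane_normal \<phi> \<bullet> \<sigma> \<ge> 0}"

lemma axis_e: "axis k 1 \<bullet> x = x $ k" "x \<bullet> axis k 1 = x $ k" "norm (axis k (1::real) :: real ^ 'n) = 1"
  by (simp_all add: inner_axis inner_axis' norm_axis_1)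

lemma norm_plane_normal: "norm (plane_normal \<phi>) = 1"
proof -
  have "e \<bullet> e = 1" using e by (simp add: norm_eq_1)
  then have "plane_normal \<phi> \<bullet> plane_normal \<phi> = (cos \<phi>)\<^sup>2 + (sin \<phi>)\<^sup>2"
    unfolding plane_normal_def using e axis_e(1,2)[of e] axis_e(1,2)[of "axis k 1"]
    by (simp add: inner_diff_left inner_diff_right power2_eq_square axis_def)
  then show ?thesis by (simp add: norm_eq_1)
qed

lemma reflect_height: "reflect \<phi> x $ k = x $ k + 2 * cos \<phi> * (plane_normal \<phi> \<bullet> x)"
  using e by (simp add: reflect_def plane_normal_def[of \<phi>] inner_commute[of x] axis_def algebra_simps)

lemmas reflect_isometry = sgn_reflection[OF norm_plane_normal reflect_def]

text \<open>Because \<open>cos \<phi> \<ge> 0\<close>, the reflection cannot lower a point of the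
  lune; so on lunes the gap evaluates \<open>v\<close> only on the closed hemisphere.\<close>

lemma lune_hemisphere:
  assumes "\<phi> \<in> {0..pi/2}" "\<sigma> \<in> lune \<phi>"
  shows "\<sigma> \<in> closure (upper_hemisphere k)" "reflect \<phi> \<sigma> \<in> closure (upper_hemisphere k)"
    and "0 < \<sigma> $ k \<Longrightarrow> \<sigma> \<in> upper_hemisphere k \<and> reflect \<phi> \<sigma> \<in> upper_hemisphere k"
proof -
  have s: "norm \<sigma> = 1" "\<sigma> $ k \<ge> 0" "plane_normal \<phi> \<bullet> \<sigma> \<ge> 0"
    using assms(2) by (auto simp: lune_def axis_e)
  have "cos \<phi> \<ge> 0" using assms(1) by (intro cos_ge_zero) auto
  then have "reflect \<phi> \<sigma> $ k \<ge> \<sigma> $ k" using s by (simp add: reflect_height)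
  then show "\<sigma> \<in> closure (upper_hemisphere k)" "reflect \<phi> \<sigma> \<in> closure (upper_hemisphere k)"
    "0 < \<sigma> $ k \<Longrightarrow> \<sigma> \<in> upper_hemisphere k \<and> reflect \<phi> \<sigma> \<in> upper_hemisphere k"
    using s reflect_isometry(1)[of \<phi> \<sigma>] unfolding closure_upper_hemisphere
    by (auto simp: upper_hemisphere_def)
qed

lemma v_continuous: "continuous_on (closure (upper_hemisphere k)) v"
  by (rule positive_solution_continuous[OF v])

lemma v_pos: "\<sigma> \<in> upper_hemisphere k \<Longrightarrow> v \<sigma> > 0"
  using v unfolding positive_solution_def by blast

lemma v_nonneg: "\<sigma> \<in> closure (upper_hemisphere k) \<Longrightarrow> v \<sigma> \<ge> 0"
  and v_zero: "norm \<sigma> = 1 \<Longrightarrow> \<sigma> $ k = 0 \<Longrightarrow> v \<sigma> = 0"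
  using v v_pos[of \<sigma>] unfolding positive_solution_def closure_upper_hemisphere
  by (cases "\<sigma> $ k = 0"; auto simp: upper_hemisphere_def hemisphere_boundary_def)+

text \<open>Joint continuity in angle and point, for the limits in which the plane moves. As
  \<open>v\<close> is controlled on the closed hemisphere only, the approach has to stay inside the
  lunes.\<close>

lemma tendsto_reflection_gap:
  assumes "\<phi> \<in> {0..pi/2}" "\<sigma> \<in> lune \<phi>" "(f \<longlongrightarrow> \<phi>) F" "(g \<longlongrightarrow> \<sigma>) F"
    and "\<forall>\<^sub>F n in F. f n \<in> {0..pi/2} \<and> g n \<in> lune (f n)"
  shows "((\<lambda>n. reflection_gap (f n) (g n)) \<longlongrightarrow> reflection_gap \<phi> \<sigma>) F"
proof -
  have r: "((\<lambda>n. reflect (f n) (g n)) \<longlongrightarrow> reflect \<phi> \<sigma>) F"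
    unfolding reflect_def plane_normal_def
    by (intro tendsto_intros isCont_tendsto_compose[OF isCont_cos assms(3)]
        isCont_tendsto_compose[OF isCont_sin assms(3)] assms(4))
  have "\<forall>\<^sub>F n in F. reflect (f n) (g n) \<in> closure (upper_hemisphere k)"
    "\<forall>\<^sub>F n in F. g n \<in> closure (upper_hemisphere k)"
    by (rule eventually_mono[OF assms(5)], metis lune_hemisphere(1,2))+
  then show ?thesis
    unfolding reflection_gap_def
    by (intro tendsto_diff continuous_on_tendsto_compose[OF v_continuous] r assms(4)
        lune_hemisphere[OF assms(1,2)])
qed

lemma reflection_gap_continuous: "\<phi> \<in> {0..pi/2} \<Longrightarrow> continuous_on (lune \<phi>) (reflection_gap \<phi>)"
  unfolding continuous_on_def
  by (intro ballI tendsto_reflection_gap tendsto_const tendsto_ident_at) (auto simp: eventually_at_filter)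

lemma reflection_gap_laplacian:
  assumes "\<phi> \<in> {0..pi/2}" "\<sigma> \<in> lune \<phi>" "0 < \<sigma> $ k"
  shows "has_laplacian (\<lambda>x. reflection_gap \<phi> (sgn x))
    (- lam * reflection_gap \<phi> \<sigma> - (v (reflect \<phi> \<sigma>) powr q - v \<sigma> powr q)) \<sigma>"
proof -
  define L1 L2 where "L1 = - (lam * v (reflect \<phi> \<sigma>) + v (reflect \<phi> \<sigma>) powr q)"
    and "L2 = - (lam * v \<sigma> + v \<sigma> powr q)"
  have "has_laplacian (\<lambda>x. v (sgn (reflect \<phi> x))) L1 \<sigma>"
    unfolding L1_def
    by (rule has_laplacian_reflection[OF norm_plane_normal reflect_def positive_solution_laplacian[OF v]])
      (use lune_hemisphere(3)[OF assms] in auto)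
  moreover have "has_laplacian (\<lambda>x. v (sgn x)) L2 \<sigma>"
    unfolding L2_def using lune_hemisphere(3)[OF assms] by (intro positive_solution_laplacian[OF v]) auto
  ultimately have "has_laplacian (\<lambda>x. v (sgn (reflect \<phi> x)) + (- 1) * v (sgn x)) (L1 + (- 1) * L2) \<sigma>"
    by (intro has_laplacian_add has_laplacian_cmult)
  moreover have "L1 + (- 1) * L2 = - lam * reflection_gap \<phi> \<sigma> - (v (reflect \<phi> \<sigma>) powr q - v \<sigma> powr q)"
    by (simp add: L1_def L2_def reflection_gap_def algebra_simps)
  ultimately show ?thesis
    by (simp add: reflection_gap_def reflect_isometry(2))
qed

text \<open>Points of the mirror are fixed, and on the equator \<open>v\<close> vanishes while its
  reflected value is nonnegative.\<close>

lemma reflection_gap_boundary: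
  assumes "\<phi> \<in> {0..pi/2}" "\<sigma> \<in> lune \<phi>" "\<sigma> $ k = 0 \<or> plane_normal \<phi> \<bullet> \<sigma> = 0"
  shows "0 \<le> reflection_gap \<phi> \<sigma>"
proof (cases "plane_normal \<phi> \<bullet> \<sigma> = 0")
  case True
  then show ?thesis by (simp add: reflection_gap_def reflect_def inner_commute)
next
  case False
  then have "v \<sigma> = 0" using assms by (intro v_zero) (auto simp: lune_def)
  then show ?thesis using v_nonneg[OF lune_hemisphere(2)[OF assms(1,2)]] by (simp add: reflection_gap_def)
qed

text \<open>By the strong maximum principle one interior point with positive gap is enough. At
  \<open>- e\<close> the solution vanishes, but the mirror image has height
  \<open>2 * cos \<phi> * sin \<phi> > 0\<close>; continuity carries the positivity into the
  interior. This height is \<open>0\<close> at both excluded angles.\<close>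

lemma reflection_gap_positive:
  assumes t: "0 < \<phi>" "\<phi> < pi/2" and nonneg: "\<And>\<sigma>. \<sigma> \<in> lune \<phi> \<Longrightarrow> 0 \<le> reflection_gap \<phi> \<sigma>"
    and y: "norm y = 1" "0 < y $ k" "0 < plane_normal \<phi> \<bullet> y"
  shows "0 < reflection_gap \<phi> y"
proof -
  define V where "V = {x :: real ^ 'n. axis k 1 \<bullet> x > 0} \<inter> {x. plane_normal \<phi> \<bullet> x > 0}"
  have t': "\<phi> \<in> {0..pi/2}" using t by auto
  have oV: "open V" unfolding V_def by (intro open_Int open_halfspace_gt)
  have sub: "sphere 0 1 \<inter> V \<subseteq> lune \<phi>" by (auto simp: V_def lune_def)
  have nz: "x \<noteq> 0" if "x \<in> V" for x using that by (auto simp: V_def)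
  \<comment> \<open>The open lune is the radial projection of a convex cone, hence
    connected.\<close>
  have "sphere 0 1 \<inter> V = sgn ` V"
  proof
    show "sphere 0 1 \<inter> V \<subseteq> sgn ` V"
    proof
      fix x assume "x \<in> sphere 0 1 \<inter> V"
      then show "x \<in> sgn ` V" by (intro image_eqI[of _ _ x]) (auto simp: sgn_div_norm)
    qed
    show "sgn ` V \<subseteq> sphere 0 1 \<inter> V"
      using nz by (auto simp: V_def sgn_div_norm)
  qed
  moreover have "connected V" unfolding V_def
    by (intro convex_connected convex_Int convex_halfspace_gt)
  then have "connected (sgn ` V)"
    using nz by (intro connected_continuous_image continuous_on_sgn continuous_on_id) auto
  ultimately have conn: "connected (sphere 0 1 \<inter> V)" by simp
  have cont: "continuous_on (sphere 0 1 \<inter> V) (reflection_gap \<phi>)"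
    by (rule continuous_on_subset[OF reflection_gap_continuous[OF t'] sub])
  define c where "c s = cos s *\<^sub>R (- e) + sin s *\<^sub>R axis k 1" for s
  have ck: "axis k 1 \<bullet> c s = sin s" "plane_normal \<phi> \<bullet> c s = sin (\<phi> - s)" for s
    using e norm_eq_1[of e] axis_e(1,2)[of e] axis_e(1,2)[of "axis k 1"]
    by (simp_all add: c_def plane_normal_def axis_e inner_add_right inner_diff_left sin_diff axis_def algebra_simps)
  have nc: "norm (c s) = 1" for s
    unfolding c_def using e by (intro great_circle_norm) (auto simp: axis_e)
  have cl: "c s \<in> lune \<phi>" if "0 \<le> s" "s < \<phi>" for s
    using that t nc[of s] by (auto simp: lune_def ck intro!: sin_ge_zero)
  have "c 0 \<in> lune \<phi>" using cl[of 0] t by simp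
  have "reflect \<phi> (c 0) $ k = 2 * cos \<phi> * sin \<phi>"
    unfolding reflect_height ck using ck(1)[of 0] by (simp add: axis_e)
  moreover have "cos \<phi> > 0" "sin \<phi> > 0" using t by (auto intro!: cos_gt_zero sin_gt_zero)
  ultimately have "reflect \<phi> (c 0) \<in> upper_hemisphere k"
    using reflect_isometry(1)[of \<phi> "c 0"] nc[of 0] by (auto simp: upper_hemisphere_def)
  then have "v (reflect \<phi> (c 0)) > 0" by (rule v_pos)
  moreover have "v (c 0) = 0" using nc[of 0] ck(1)[of 0] by (intro v_zero) (auto simp: axis_e)
  ultimately have pos0: "reflection_gap \<phi> (c 0) > 0" by (simp add: reflection_gap_def)
  have "((\<lambda>s. reflection_gap \<phi> (c s)) \<longlongrightarrow> reflection_gap \<phi> (c 0)) (at_right 0)"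
  proof (rule tendsto_reflection_gap[OF t' \<open>c 0 \<in> lune \<phi>\<close> tendsto_const])
    have "isCont c 0" unfolding c_def by (intro continuous_intros)
    then show "(c \<longlongrightarrow> c 0) (at_right 0)" by (simp add: isCont_def filterlim_at_split)
    show "\<forall>\<^sub>F s in at_right 0. \<phi> \<in> {0..pi/2} \<and> c s \<in> lune \<phi>"
      using eventually_at_right_real[OF t(1)] by eventually_elim (use cl t' in auto)
  qed
  then have "\<forall>\<^sub>F s in at_right 0. reflection_gap \<phi> (c s) > 0" using pos0 by (rule order_tendstoD(1))
  then have "\<forall>\<^sub>F s in at_right 0. reflection_gap \<phi> (c s) > 0 \<and> s \<in> {0<..<\<phi>}"
    using eventually_at_right_real[OF t(1)] by (rule eventually_conj)
  then obtain s where s: "reflection_gap \<phi> (c s) > 0" "0 < s" "s < \<phi>"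
    using eventually_happens'[OF trivial_limit_at_right_real[of 0]] by fastforce
  show ?thesis
  proof (rule strong_maximum_principle[OF oV conn, of "\<bar>lam\<bar>" "reflection_gap \<phi>" "c s" y])
    show "c s \<in> sphere 0 1 \<inter> V"
      using s t nc[of s] by (auto simp: V_def ck intro!: sin_gt_zero)
    show "y \<in> sphere 0 1 \<inter> V" using y by (auto simp: V_def axis_e)
    fix \<sigma> assume "\<sigma> \<in> sphere 0 1 \<inter> V"
    then have \<sigma>: "\<sigma> \<in> lune \<phi>" "0 < \<sigma> $ k" using sub by (auto simp: V_def axis_e)
    show nn: "0 \<le> reflection_gap \<phi> \<sigma>" by (rule nonneg[OF \<sigma>(1)])
    have "v \<sigma> powr q \<le> v (reflect \<phi> \<sigma>) powr q"
      using nn q v_nonneg[OF lune_hemisphere(1)[OF t' \<sigma>(1)]]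
      by (intro powr_mono2) (auto simp: reflection_gap_def)
    moreover have "- lam * reflection_gap \<phi> \<sigma> \<le> \<bar>lam\<bar> * reflection_gap \<phi> \<sigma>"
      using nn by (intro mult_right_mono) auto
    ultimately show "\<exists>L. has_laplacian (\<lambda>x. reflection_gap \<phi> (sgn x)) L \<sigma> \<and> L \<le> \<bar>lam\<bar> * reflection_gap \<phi> \<sigma>"
      using reflection_gap_laplacian[OF t' \<sigma>] by force
  qed (use cont s in auto)
qed

text \<open>Covers the start \<open>t = 0\<close> as well as the continuation. Negative gaps at
  height at least \<open>\<epsilon>\<close> over both sides, for angles tending to \<open>t\<close>,
  would accumulate at a point inside \<open>lune t\<close> with gap at most \<open>0\<close>,
  contradicting \<open>reflection_gap_positive\<close>; for \<open>t = 0\<close> no such point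
  exists. The strips along the sides fall to \<open>lune_maximum_principle\<close>, whose constant
  \<open>C\<close> is the same for all angles.\<close>

lemma moving_plane_step:
  assumes t: "0 \<le> t" "t < pi/2" and nonneg: "\<And>\<sigma>. \<sigma> \<in> lune t \<Longrightarrow> 0 \<le> reflection_gap t \<sigma>"
  shows "\<exists>\<delta>>0. \<forall>\<phi>\<in>{t..pi/2}. \<phi> < t + \<delta> \<longrightarrow> (\<forall>\<sigma>\<in>lune \<phi>. 0 \<le> reflection_gap \<phi> \<sigma>)"
proof -
  have "bounded (upper_hemisphere k)"
    by (rule bounded_subset[OF bounded_sphere[of 0 1]]) (auto simp: upper_hemisphere_def)
  then have "bounded (v ` closure (upper_hemisphere k))"
    by (intro compact_imp_bounded compact_continuous_image v_continuous) simp
  then obtain B where B: "B > 0" "\<And>\<sigma>. \<sigma> \<in> closure (upper_hemisphere k) \<Longrightarrow> v \<sigma> \<le> B"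
    unfolding bounded_pos by (metis image_eqI real_norm_def abs_le_D1)
  define C where "C = \<bar>lam\<bar> + q * B powr (q - 1)"
  have C: "C \<ge> 0" using q by (simp add: C_def)
  define \<epsilon> where "\<epsilon> = 1 / (8 * (C + 1))"
  have eps: "\<epsilon> > 0" using C by (simp add: \<epsilon>_def)
  have "\<exists>\<delta>>0. \<forall>\<phi>\<in>{t..pi/2}. \<phi> < t + \<delta> \<longrightarrow>
      (\<forall>\<sigma>\<in>lune \<phi>. \<epsilon> \<le> \<sigma> $ k \<longrightarrow> \<epsilon> \<le> plane_normal \<phi> \<bullet> \<sigma> \<longrightarrow> 0 \<le> reflection_gap \<phi> \<sigma>)"
  proof (rule ccontr)
    assume no: "\<not> ?thesis"
    have "\<exists>\<phi> \<sigma>. \<phi> \<in> {t..pi/2} \<and> \<phi> < t + inverse (real (Suc n)) \<and> \<sigma> \<in> lune \<phi> \<and>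
        \<epsilon> \<le> \<sigma> $ k \<and> \<epsilon> \<le> plane_normal \<phi> \<bullet> \<sigma> \<and> reflection_gap \<phi> \<sigma> < 0" for n
    proof -
      have "inverse (real (Suc n)) > 0" by simp
      then show ?thesis using no by (meson not_le)
    qed
    then obtain f g where fg: "\<And>n. f n \<in> {t..pi/2}" "\<And>n. f n < t + inverse (real (Suc n))"
        "\<And>n. g n \<in> lune (f n)" "\<And>n. \<epsilon> \<le> g n $ k" "\<And>n. \<epsilon> \<le> plane_normal (f n) \<bullet> g n"
        "\<And>n. reflection_gap (f n) (g n) < 0"
      by metis
    have "f \<longlonglongrightarrow> t"
    proof (rule tendsto_sandwich[OF _ _ tendsto_const])
      show "(\<lambda>n. t + inverse (real (Suc n))) \<longlonglongrightarrow> t"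
        using tendsto_add[OF tendsto_const LIMSEQ_inverse_real_of_nat, of t] by simp
      show "\<forall>\<^sub>F n in sequentially. t \<le> f n" using fg(1) by auto
      show "\<forall>\<^sub>F n in sequentially. f n \<le> t + inverse (real (Suc n))"
        using fg(2) by (intro always_eventually allI less_imp_le)
    qed
    have "compact (sphere (0 :: real ^ 'n) 1)" by simp
    moreover have "\<forall>n. g n \<in> sphere 0 1" using fg(3) by (auto simp: lune_def)
    ultimately obtain l r where l: "l \<in> sphere 0 1" "strict_mono r" "(g \<circ> r) \<longlonglongrightarrow> l"
      unfolding compact_def by metis
    have fr: "(\<lambda>n. f (r n)) \<longlonglongrightarrow> t"
      using LIMSEQ_subseq_LIMSEQ[OF \<open>f \<longlonglongrightarrow> t\<close> l(2)] by (simp add: o_def)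
    have gr: "(\<lambda>n. g (r n)) \<longlonglongrightarrow> l" using l(3) by (simp add: o_def)
    have "(\<lambda>n. g (r n) $ k) \<longlonglongrightarrow> l $ k" by (intro tendsto_intros gr)
    then have lk: "\<epsilon> \<le> l $ k" by (rule tendsto_lowerbound) (use fg(4) in auto)
    have "(\<lambda>n. plane_normal (f (r n)) \<bullet> g (r n)) \<longlonglongrightarrow> plane_normal t \<bullet> l"
      unfolding plane_normal_def
      by (intro tendsto_intros isCont_tendsto_compose[OF isCont_cos fr]
          isCont_tendsto_compose[OF isCont_sin fr] gr)
    then have ln: "\<epsilon> \<le> plane_normal t \<bullet> l" by (rule tendsto_lowerbound) (use fg(5) in auto)
    have f0: "f n \<in> {0..pi/2}" for n using fg(1)[of n] t by auto
    have ll: "l \<in> lune t" using l(1) lk ln eps by (simp add: lune_def axis_e)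
    have "t \<noteq> 0"
    proof
      assume "t = 0"
      then have "plane_normal t \<bullet> l = - (l $ k)" by (simp add: plane_normal_def axis_e)
      then show False using lk ln eps by simp
    qed
    then have "0 < reflection_gap t l"
      using t nonneg l(1) lk ln eps by (intro reflection_gap_positive) auto
    moreover have "(\<lambda>n. reflection_gap (f (r n)) (g (r n))) \<longlonglongrightarrow> reflection_gap t l"
      using t ll fr gr fg(3) f0 by (intro tendsto_reflection_gap) auto
    then have "reflection_gap t l \<le> 0"
      by (rule tendsto_upperbound) (auto intro!: always_eventually less_imp_le[OF fg(6)])
    ultimately show False by simp
  qed
  then obtain \<delta> where \<delta>: "\<delta> > 0" "\<And>\<phi> \<sigma>. \<phi> \<in> {t..pi/2} \<Longrightarrow> \<phi> < t + \<delta> \<Longrightarrow> \<sigma> \<in> lune \<phi> \<Longrightarrow>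
      \<epsilon> \<le> \<sigma> $ k \<Longrightarrow> \<epsilon> \<le> plane_normal \<phi> \<bullet> \<sigma> \<Longrightarrow> 0 \<le> reflection_gap \<phi> \<sigma>"
    by metis
  have "0 \<le> reflection_gap \<phi> \<sigma>" if phi: "\<phi> \<in> {t..pi/2}" "\<phi> < t + \<delta>" and \<sigma>: "\<sigma> \<in> lune \<phi>" for \<phi> \<sigma>
  proof -
    have p: "\<phi> \<in> {0..pi/2}" using phi t by auto
    note D = lune_def[of \<phi>, symmetric]
    show ?thesis
    proof (rule lune_maximum_principle[OF axis_e(3) norm_plane_normal[of \<phi>] C, of "reflection_gap \<phi>", unfolded D])
      show "continuous_on (lune \<phi>) (reflection_gap \<phi>)" by (rule reflection_gap_continuous[OF p])
      fix s assume s: "s \<in> lune \<phi>"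
      show "0 \<le> reflection_gap \<phi> s" if "axis k 1 \<bullet> s = 0 \<or> plane_normal \<phi> \<bullet> s = 0"
        using reflection_gap_boundary[OF p s] that by (simp add: axis_e)
      show "0 \<le> reflection_gap \<phi> s"
        if "1 / (8 * (C + 1)) \<le> axis k 1 \<bullet> s" "1 / (8 * (C + 1)) \<le> plane_normal \<phi> \<bullet> s"
        using \<delta>(2)[OF phi s] that by (simp add: axis_e \<epsilon>_def)
      show "\<exists>L. has_laplacian (\<lambda>x. reflection_gap \<phi> (sgn x)) L s \<and> L \<le> - C * reflection_gap \<phi> s"
        if "axis k 1 \<bullet> s > 0" "reflection_gap \<phi> s < 0"
      proof -
        define w where "w = reflection_gap \<phi> s"
        have sk: "0 < s $ k" using that by (simp add: axis_e)
        have pos: "0 < v s" "0 < v (reflect \<phi> s)"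
          using lune_hemisphere(3)[OF p s sk] v_pos by auto
        have "\<bar>v (reflect \<phi> s) powr q - v s powr q\<bar> \<le> q * B powr (q - 1) * \<bar>v (reflect \<phi> s) - v s\<bar>"
          using pos B(2) lune_hemisphere(1,2)[OF p s] q by (intro powr_diff_bound) auto
        also have "\<dots> = - (q * B powr (q - 1)) * w"
          using that by (simp add: w_def reflection_gap_def right_diff_distrib)
        finally have 1: "- (v (reflect \<phi> s) powr q - v s powr q) \<le> - (q * B powr (q - 1)) * w" by linarith
        have 2: "- lam * w \<le> - \<bar>lam\<bar> * w"
          using that by (intro mult_right_mono_neg) (auto simp: w_def)
        have "- C * w = - \<bar>lam\<bar> * w + - (q * B powr (q - 1)) * w" by (simp add: C_def algebra_simps)
        then have "- lam * w - (v (reflect \<phi> s) powr q - v s powr q) \<le> - C * w" using 1 2 by linarith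
        then show ?thesis using reflection_gap_laplacian[OF p s sk] unfolding w_def by blast
      qed
    qed (rule \<sigma>)
  qed
  then show ?thesis using \<delta>(1) by blast
qed

text \<open>Real induction on the angle: nonnegativity passes to limits from below and extends past
  every angle below \<open>pi/2\<close>, so the set of failing angles cannot have an
  infimum.\<close>

lemma moving_plane:
  assumes "\<phi> \<in> {0..pi/2}" "\<sigma> \<in> lune \<phi>"
  shows "0 \<le> reflection_gap \<phi> \<sigma>"
proof -
  define P where "P \<phi> \<longleftrightarrow> (\<forall>\<sigma>\<in>lune \<phi>. 0 \<le> reflection_gap \<phi> \<sigma>)" for \<phi>
  have closed: "P t" if t: "t \<in> {0..pi/2}" and less: "\<And>s. 0 \<le> s \<Longrightarrow> s < t \<Longrightarrow> P s" for t
    unfolding P_def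
  proof
    fix \<sigma> assume \<sigma>: "\<sigma> \<in> lune t"
    then have s: "\<sigma> $ k \<ge> 0" "plane_normal t \<bullet> \<sigma> \<ge> 0" by (auto simp: lune_def axis_e)
    show "0 \<le> reflection_gap t \<sigma>"
    proof (cases "plane_normal t \<bullet> \<sigma> = 0")
      case True
      then show ?thesis using reflection_gap_boundary[OF t \<sigma>] by blast
    next
      case False
      have "t \<noteq> 0"
      proof
        assume "t = 0"
        then have "plane_normal t \<bullet> \<sigma> = - (\<sigma> $ k)" by (simp add: plane_normal_def axis_e)
        then show False using False s by simp
      qed
      then have "0 < t" using t by auto
      \<comment> \<open>A point strictly on the positive side of the mirror lies in
        \<open>lune x\<close> for all \<open>x\<close> slightly below \<open>t\<close>, so its gap
        is a limit of nonnegative ones.\<close>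
      have "((\<lambda>x. plane_normal x \<bullet> \<sigma>) \<longlongrightarrow> plane_normal t \<bullet> \<sigma>) (at_left t)"
        unfolding plane_normal_def
        by (intro tendsto_intros isCont_tendsto_compose[OF isCont_cos] isCont_tendsto_compose[OF isCont_sin])
      then have "\<forall>\<^sub>F x in at_left t. plane_normal x \<bullet> \<sigma> > 0"
        using False s by (intro order_tendstoD(1)) auto
      then have ev: "\<forall>\<^sub>F x in at_left t. x \<in> {0<..<t} \<and> \<sigma> \<in> lune x"
        using eventually_at_left_real[OF \<open>0 < t\<close>]
        by eventually_elim (use \<sigma> in \<open>auto simp: lune_def\<close>)
      have "((\<lambda>x. reflection_gap x \<sigma>) \<longlongrightarrow> reflection_gap t \<sigma>) (at_left t)"
        by (rule tendsto_reflection_gap[OF t \<sigma> tendsto_ident_at tendsto_const])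
          (rule eventually_mono[OF ev], use t in auto)
      then show ?thesis
        by (rule tendsto_lowerbound) (rule eventually_mono[OF ev], use less P_def in auto)
    qed
  qed
  have step: "\<exists>\<delta>>0. \<forall>s\<in>{t..pi/2}. s < t + \<delta> \<longrightarrow> P s" if "0 \<le> t" "t < pi/2" "P t" for t
    using moving_plane_step[OF that(1,2)] that(3) unfolding P_def by blast
  have "P \<phi>"
  proof (rule ccontr)
    assume "\<not> P \<phi>"
    define F where "F = {s \<in> {0..pi/2}. \<not> P s}"
    have F: "\<phi> \<in> F" "bdd_below F"
      using assms \<open>\<not> P \<phi>\<close> by (auto simp: F_def intro!: bdd_belowI[of _ 0])
    define i where "i = Inf F"
    have i: "0 \<le> i" "i \<le> \<phi>"
      unfolding i_def using F by (auto intro!: cInf_greatest cInf_lower simp: F_def)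
    have Pi: "P i"
    proof (rule closed)
      show "i \<in> {0..pi/2}" using i assms by auto
      fix s assume s: "0 \<le> s" "s < i"
      then have "s \<notin> F" using cInf_lower[OF _ F(2), of s] by (auto simp: i_def)
      then show "P s" using s i assms by (auto simp: F_def)
    qed
    then have "i \<noteq> \<phi>" using \<open>\<not> P \<phi>\<close> by auto
    then have "i < pi/2" using i assms by auto
    then obtain \<delta> where \<delta>: "\<delta> > 0" "\<And>s. s \<in> {i..pi/2} \<Longrightarrow> s < i + \<delta> \<Longrightarrow> P s"
      using step[OF i(1) _ Pi] by blast
    obtain s where "s \<in> F" "s < i + \<delta>"
      using cInf_lessD[of F "i + \<delta>"] F \<delta>(1) by (auto simp: i_def)
    moreover have "i \<le> s" using cInf_lower[OF \<open>s \<in> F\<close> F(2)] by (simp add: i_def)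
    ultimately show False using \<delta>(2)[of s] by (auto simp: F_def)
  qed
  then show ?thesis using assms P_def by blast
qed

lemma reflection_monotone:
  assumes "\<sigma> \<in> closure (upper_hemisphere k)" "e \<bullet> \<sigma> \<le> 0"
  shows "v \<sigma> \<le> v (\<sigma> - (2 * (e \<bullet> \<sigma>)) *\<^sub>R e)"
proof -
  have "plane_normal (pi/2) = - e" by (simp add: plane_normal_def)
  moreover from this have "\<sigma> \<in> lune (pi/2)"
    using assms by (auto simp: lune_def closure_upper_hemisphere axis_e)
  ultimately show ?thesis
    using moving_plane[of "pi/2" \<sigma>] by (simp add: reflection_gap_def reflect_def inner_commute)
qed

end

text \<open>The inequality for \<open>e\<close> and the one for \<open>- e\<close> together cover
  the hemisphere; applied also to the mirror image they give the reverse inequality.\<close>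

lemma positive_solution_reflection:
  assumes v: "positive_solution k lam q v" and q: "q > 1" and e: "norm e = 1" "e $ k = 0"
    and s: "\<sigma> \<in> closure (upper_hemisphere k)"
  shows "v (\<sigma> - (2 * (e \<bullet> \<sigma>)) *\<^sub>R e) = v \<sigma>"
proof -
  have *: "v \<tau> \<le> v (\<tau> - (2 * (e \<bullet> \<tau>)) *\<^sub>R e)" if "\<tau> \<in> closure (upper_hemisphere k)" for \<tau>
    using reflection_monotone[OF v q e that] reflection_monotone[OF v q, of "- e" \<tau>] e that
    by (cases "e \<bullet> \<tau> \<le> 0") auto
  define \<tau> where "\<tau> = \<sigma> - (2 * (e \<bullet> \<sigma>)) *\<^sub>R e"
  have ee: "e \<bullet> e = 1" using e by (simp add: norm_eq_1)
  have "\<tau> \<bullet> \<tau> = \<sigma> \<bullet> \<sigma>"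
    by (simp add: \<tau>_def inner_diff_left inner_diff_right ee inner_commute[of \<sigma> e])
  then have "norm \<tau> = norm \<sigma>" by (simp add: norm_eq_sqrt_inner)
  then have "\<tau> \<in> closure (upper_hemisphere k)"
    using s e by (auto simp: closure_upper_hemisphere \<tau>_def)
  from *[OF this] have "v \<tau> \<le> v \<sigma>"
    by (simp add: \<tau>_def inner_diff_right ee)
  then show ?thesis using *[OF s] by (simp add: \<tau>_def)
qed

text \<open>Two points of equal height are exchanged by the reflection in direction
  \<open>\<sigma> - \<tau>\<close>, and equal height makes this direction horizontal.\<close>

theorem positive_solution_axially_symmetric:
  assumes v: "positive_solution k lam q v" and q: "q > 1"
    and s: "\<sigma> \<in> closure (upper_hemisphere k)" "\<tau> \<in> closure (upper_hemisphere k)" "\<sigma> $ k = \<tau> $ k"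
  shows "v \<sigma> = v \<tau>"
proof (cases "\<sigma> = \<tau>")
  case False
  define d where "d = norm (\<sigma> - \<tau>)"
  have d: "d > 0" "d\<^sup>2 = (\<sigma> - \<tau>) \<bullet> (\<sigma> - \<tau>)" using False by (auto simp: d_def power2_norm_eq_inner)
  define e where "e = (1 / d) *\<^sub>R (\<sigma> - \<tau>)"
  have "norm e = 1" "e $ k = 0" using False s by (auto simp: e_def d_def)
  then have "v (\<sigma> - (2 * (e \<bullet> \<sigma>)) *\<^sub>R e) = v \<sigma>"
    by (rule positive_solution_reflection[OF v q _ _ s(1)])
  moreover have "(2 * (e \<bullet> \<sigma>)) *\<^sub>R e = \<sigma> - \<tau>"
  proof -
    have "\<sigma> \<bullet> \<sigma> = 1" "\<tau> \<bullet> \<tau> = 1" using s by (auto simp: closure_upper_hemisphere norm_eq_1)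
    then have "2 * ((\<sigma> - \<tau>) \<bullet> \<sigma>) = d\<^sup>2"
      by (simp add: d inner_diff_left inner_diff_right inner_commute)
    moreover have "e \<bullet> \<sigma> = ((\<sigma> - \<tau>) \<bullet> \<sigma>) / d" unfolding e_def inner_scaleR_left by simp
    ultimately have "2 * (e \<bullet> \<sigma>) = d" using d(1) by (simp add: power2_eq_square)
    then show ?thesis using d(1) by (simp add: e_def)
  qed
  ultimately show ?thesis by simp
qed simp

section \<open>Reduction to the radial equation\<close>

definition meridian :: "'n::finite \<Rightarrow> real ^ 'n \<Rightarrow> real \<Rightarrow> real ^ 'n" where
  "meridian k e \<theta> = cos \<theta> *\<^sub>R axis k 1 + sin \<theta> *\<^sub>R e"

definition meridian_tangent :: "'n::finite \<Rightarrow> real ^ 'n \<Rightarrow> real \<Rightarrow> real ^ 'n" where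
  "meridian_tangent k e \<theta> = (- sin \<theta>) *\<^sub>R axis k 1 + cos \<theta> *\<^sub>R e"

lemma meridian_height: "e $ k = 0 \<Longrightarrow> meridian k e \<theta> $ k = cos \<theta>"
  by (simp add: meridian_def axis_def)

lemma norm_meridian: "norm e = 1 \<Longrightarrow> e $ k = 0 \<Longrightarrow> norm (meridian k e \<theta>) = 1"
  unfolding meridian_def by (rule great_circle_norm) (auto simp: inner_axis norm_axis_1)

lemma meridian_in:
  assumes "norm e = 1" "e $ k = 0"
  shows "\<theta> \<in> {0..pi/2} \<Longrightarrow> meridian k e \<theta> \<in> closure (upper_hemisphere k)"
    and "\<theta> \<in> {0..<pi/2} \<Longrightarrow> meridian k e \<theta> \<in> upper_hemisphere k"
  using norm_meridian[OF assms, of \<theta>] meridian_height[OF assms(2), of \<theta>]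
  unfolding closure_upper_hemisphere by (auto simp: upper_hemisphere_def intro!: cos_ge_zero cos_gt_zero_pi)

lemma meridian_derivative:
  "(meridian k e has_vector_derivative meridian_tangent k e \<theta>) (at \<theta> within S)"
  "(meridian_tangent k e has_vector_derivative - meridian k e \<theta>) (at \<theta> within S)"
  unfolding meridian_def[abs_def] meridian_tangent_def[abs_def] has_vector_derivative_def
  by (auto intro!: derivative_eq_intros simp: algebra_simps)

text \<open>In polar coordinates the Hessian has the entry \<open>d'\<close> along the meridian and
  the eigenvalue \<open>d \<theta> * (cos \<theta> / sin \<theta>)\<close> on the
  \<open>N - 2\<close> directions tangent to the latitude sphere; its trace gives the
  equation.\<close>

lemma positive_solution_radial:
  fixes v :: "real ^ 'n::finite \<Rightarrow> real"
  assumes v: "positive_solution k lam q v" and q: "q > 1" and e: "norm e = 1" "e $ k = 0"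
  shows "\<exists>d. radial_solution (real CARD('n) - 2) lam q (\<lambda>\<theta>. v (meridian k e \<theta>)) d"
proof -
  let ?M = "closure (upper_hemisphere k)" and ?E = "axis k (1::real)"
  obtain g A where gA: "\<And>\<sigma>. \<sigma> \<in> ?M \<Longrightarrow> g \<sigma> \<bullet> \<sigma> = 0"
    "\<And>\<sigma>. \<sigma> \<in> ?M \<Longrightarrow> (v has_derivative (\<lambda>h. g \<sigma> \<bullet> h)) (at \<sigma> within ?M)"
    "\<And>\<sigma>. \<sigma> \<in> ?M \<Longrightarrow> (g has_derivative A \<sigma>) (at \<sigma> within ?M)"
    "\<And>\<sigma>. \<sigma> \<in> upper_hemisphere k \<Longrightarrow>
      (\<Sum>b\<in>Basis. A \<sigma> (tangent_proj \<sigma> b) \<bullet> b) = - (lam * v \<sigma> + v \<sigma> powr q)"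
    by (rule positive_solutionD[OF v]) blast
  define u where "u \<theta> = v (meridian k e \<theta>)" for \<theta>
  define d where "d \<theta> = g (meridian k e \<theta>) \<bullet> meridian_tangent k e \<theta>" for \<theta>
  have curve: "((\<lambda>t. f (c t)) has_vector_derivative f' c') (at t within I)"
    if "(f has_derivative f') (at (c t) within ?M)" "(c has_vector_derivative c') (at t within I)"
      "\<And>t. t \<in> I \<Longrightarrow> c t \<in> ?M"
    for f :: "real ^ 'n \<Rightarrow> 'b::real_normed_vector" and f' c c' t and I :: "real set"
  proof -
    have "(f has_derivative f') (at (c t) within c ` I)"
      by (rule has_derivative_subset[OF that(1)]) (use that(3) in auto)
    from vector_derivative_diff_chain_within[OF that(2) this] show ?thesis by (simp add: o_def)
  qed
  have sym: "v (meridian k e' \<theta>) = u \<theta>"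
    if "norm e' = 1" "e' $ k = 0" "\<theta> \<in> {0..pi/2}" for e' \<theta>
    unfolding u_def
    using meridian_in(1)[OF that] meridian_in(1)[OF e that(3)]
    by (rule positive_solution_axially_symmetric[OF v q]) (simp add: meridian_height e that)
  have du: "((\<lambda>\<theta>. u \<theta>) has_vector_derivative g (meridian k e' \<theta>) \<bullet> meridian_tangent k e' \<theta>) (at \<theta> within {0..pi/2})"
    if "norm e' = 1" "e' $ k = 0" "\<theta> \<in> {0..pi/2}" for e' \<theta>
  proof -
    have "((\<lambda>\<theta>. v (meridian k e' \<theta>)) has_vector_derivative g (meridian k e' \<theta>) \<bullet> meridian_tangent k e' \<theta>)
        (at \<theta> within {0..pi/2})"
      by (rule curve[OF gA(2) meridian_derivative(1)]) (use meridian_in(1)[OF that(1,2)] that(3) in auto)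
    then show ?thesis
      by (rule has_vector_derivative_transform[OF that(3), rotated]) (use sym that in auto)
  qed
  \<comment> \<open>Along every meridian the same function \<open>u\<close> is seen. The ends are
    included by one-sided derivatives, which is needed for \<open>d 0 = 0\<close>.\<close>
  have slope: "g (meridian k e' \<theta>) \<bullet> meridian_tangent k e' \<theta> = d \<theta>"
    if "norm e' = 1" "e' $ k = 0" "\<theta> \<in> {0..pi/2}" for e' \<theta>
    unfolding d_def
    by (rule vector_derivative_unique_within_closed_interval[unfolded box_real, OF _ _ du[OF that] du[OF e that(3)]])
      (use that in auto)
  have grad: "g (meridian k e' \<theta>) = d \<theta> *\<^sub>R meridian_tangent k e' \<theta>"
    if e': "norm e' = 1" "e' $ k = 0" and th: "\<theta> \<in> {0<..<pi/2}" for e' \<theta>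
  proof -
    define \<sigma> \<tau> where "\<sigma> = meridian k e' \<theta>" and "\<tau> = meridian_tangent k e' \<theta>"
    have th': "\<theta> \<in> {0..pi/2}" using th by auto
    have sM: "\<sigma> \<in> ?M" unfolding \<sigma>_def by (rule meridian_in(1)[OF e' th'])
    have S: "sin \<theta> > 0" using th by (intro sin_gt_zero) auto
    \<comment> \<open>Turning the meridian direction from \<open>e'\<close> towards \<open>h\<close>
      moves along the latitude sphere, on which \<open>v\<close> is constant.\<close>
    have perp: "g \<sigma> \<bullet> h = 0" if h: "norm h = 1" "h $ k = 0" "h \<bullet> e' = 0" for h
    proof -
      define c where "c t = cos \<theta> *\<^sub>R ?E + sin \<theta> *\<^sub>R (cos t *\<^sub>R e' + sin t *\<^sub>R h)" for t
      have c: "c t = meridian k (cos t *\<^sub>R e' + sin t *\<^sub>R h) \<theta>" for t by (simp add: c_def meridian_def)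
      have n: "norm (cos t *\<^sub>R e' + sin t *\<^sub>R h) = 1" "(cos t *\<^sub>R e' + sin t *\<^sub>R h) $ k = 0" for t
        using e' h by (auto intro!: great_circle_norm)
      have "c 0 = \<sigma>" by (simp add: c_def \<sigma>_def meridian_def)
      have dc: "(c has_vector_derivative sin \<theta> *\<^sub>R h) (at 0)"
        unfolding c_def has_vector_derivative_def by (auto intro!: derivative_eq_intros)
      have "((\<lambda>t. v (c t)) has_vector_derivative g \<sigma> \<bullet> (sin \<theta> *\<^sub>R h)) (at 0)"
        by (rule curve[OF _ dc]) (use gA(2)[OF sM] \<open>c 0 = \<sigma>\<close> meridian_in(1)[OF n th'] c in auto)
      moreover have "(\<lambda>t. v (c t)) = (\<lambda>t. u \<theta>)" using sym[OF n th'] c by auto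
      ultimately have "g \<sigma> \<bullet> (sin \<theta> *\<^sub>R h) = 0"
        using vector_derivative_unique_at[OF _ has_vector_derivative_const] by fastforce
      then show ?thesis using S by simp
    qed
    have ee: "e' \<bullet> e' = 1" "\<And>x. ?E \<bullet> x = x $ k" "\<And>x. x \<bullet> ?E = x $ k" "?E $ k = 1"
      using e' by (simp_all add: norm_eq_1 inner_axis inner_axis')
    have \<tau>\<tau>: "\<tau> \<bullet> \<tau> = 1"
      using sin_cos_squared_add3[of \<theta>]
      by (simp add: \<tau>_def meridian_tangent_def inner_add_left inner_add_right inner_diff_left
          inner_diff_right ee e')
    have "\<tau> \<bullet> \<sigma> = 0"
      by (simp add: \<tau>_def \<sigma>_def meridian_def meridian_tangent_def inner_add_left inner_add_right inner_diff_left
          inner_diff_right ee e')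
    define x where "x = g \<sigma> - d \<theta> *\<^sub>R \<tau>"
    have "g \<sigma> \<bullet> \<tau> = d \<theta>" using slope[OF e' th'] by (simp add: \<sigma>_def \<tau>_def)
    then have x: "x \<bullet> \<tau> = 0" "x \<bullet> \<sigma> = 0" "x \<bullet> x = g \<sigma> \<bullet> x"
      using \<tau>\<tau> gA(1)[OF sM] \<open>\<tau> \<bullet> \<sigma> = 0\<close> by (simp_all add: x_def inner_diff_left inner_diff_right inner_commute)
    have "?E = cos \<theta> *\<^sub>R \<sigma> - sin \<theta> *\<^sub>R \<tau>" "e' = sin \<theta> *\<^sub>R \<sigma> + cos \<theta> *\<^sub>R \<tau>"
      using sin_cos_squared_add3[of \<theta>]
      by (simp_all add: \<sigma>_def \<tau>_def meridian_def meridian_tangent_def algebra_simps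
          scaleR_add_left[symmetric] del: scaleR_left_distrib)
    then have xE: "x \<bullet> ?E = 0" "x \<bullet> e' = 0" using x by (metis (no_types) inner_add_right inner_diff_right inner_scaleR_right mult_zero_right add_0 diff_0_right)+
    have "x = 0"
    proof (rule ccontr)
      assume "x \<noteq> 0"
      then have "g \<sigma> \<bullet> ((1 / norm x) *\<^sub>R x) = 0"
        using xE by (intro perp) (auto simp: ee)
      then have "g \<sigma> \<bullet> x = 0" using \<open>x \<noteq> 0\<close> by simp
      then show False using x(3) \<open>x \<noteq> 0\<close> by simp
    qed
    then show ?thesis by (simp add: x_def \<sigma>_def \<tau>_def)
  qed
  \<comment> \<open>The same rotation, applied to the gradient field now known from
    \<open>grad\<close>: the curve has speed \<open>sin \<theta>\<close>, the field turns at rate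
    \<open>d \<theta> * cos \<theta>\<close>, and the quotient is the cotangent term.\<close>
  have rot: "A (meridian k e \<theta>) h = (d \<theta> * (cos \<theta> / sin \<theta>)) *\<^sub>R h"
    if th: "\<theta> \<in> {0<..<pi/2}" and h: "h $ k = 0" "h \<bullet> e = 0" for \<theta> h
  proof (cases "h = 0")
    case True
    have "linear (A (meridian k e \<theta>))"
      using gA(3)[OF meridian_in(1)[OF e, of \<theta>]] th by (auto intro: has_derivative_linear)
    then show ?thesis using True by (simp add: linear_0)
  next
    case False
    define \<sigma> where "\<sigma> = meridian k e \<theta>"
    define h1 where "h1 = (1 / norm h) *\<^sub>R h"
    have th': "\<theta> \<in> {0..pi/2}" using th by auto
    have S: "sin \<theta> > 0" using th by (intro sin_gt_zero) auto
    have sM: "\<sigma> \<in> ?M" unfolding \<sigma>_def by (rule meridian_in(1)[OF e th'])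
    have h1: "norm h1 = 1" "h1 $ k = 0" "h1 \<bullet> e = 0" using h False by (auto simp: h1_def)
    define c where "c t = cos \<theta> *\<^sub>R ?E + sin \<theta> *\<^sub>R (cos t *\<^sub>R e + sin t *\<^sub>R h1)" for t
    have c: "c t = meridian k (cos t *\<^sub>R e + sin t *\<^sub>R h1) \<theta>" for t by (simp add: c_def meridian_def)
    have n: "norm (cos t *\<^sub>R e + sin t *\<^sub>R h1) = 1" "(cos t *\<^sub>R e + sin t *\<^sub>R h1) $ k = 0" for t
      using e h1 by (auto intro!: great_circle_norm)
    have "c 0 = \<sigma>" by (simp add: c_def \<sigma>_def meridian_def)
    have dc: "(c has_vector_derivative sin \<theta> *\<^sub>R h1) (at 0)"
      unfolding c_def has_vector_derivative_def by (auto intro!: derivative_eq_intros)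
    have 1: "((\<lambda>t. g (c t)) has_vector_derivative A \<sigma> (sin \<theta> *\<^sub>R h1)) (at 0)"
      by (rule curve[OF _ dc]) (use gA(3)[OF sM] \<open>c 0 = \<sigma>\<close> meridian_in(1)[OF n th'] c in auto)
    have gc: "(\<lambda>t. g (c t)) = (\<lambda>t. d \<theta> *\<^sub>R ((- sin \<theta>) *\<^sub>R ?E + cos \<theta> *\<^sub>R (cos t *\<^sub>R e + sin t *\<^sub>R h1)))"
      using grad[OF n th] c by (simp add: meridian_tangent_def)
    have 2: "((\<lambda>t. g (c t)) has_vector_derivative d \<theta> *\<^sub>R cos \<theta> *\<^sub>R h1) (at 0)"
      unfolding gc has_vector_derivative_def by (auto intro!: derivative_eq_intros)
    have lin: "linear (A \<sigma>)" using gA(3)[OF sM] by (rule has_derivative_linear)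
    have "sin \<theta> *\<^sub>R A \<sigma> h1 = d \<theta> *\<^sub>R cos \<theta> *\<^sub>R h1"
      using vector_derivative_unique_at[OF 1 2] lin by (simp add: linear_scale)
    then have "norm h *\<^sub>R (1 / sin \<theta>) *\<^sub>R sin \<theta> *\<^sub>R A \<sigma> h1 = norm h *\<^sub>R (1 / sin \<theta>) *\<^sub>R d \<theta> *\<^sub>R cos \<theta> *\<^sub>R h1"
      by (simp only:)
    moreover have "norm h *\<^sub>R (1 / sin \<theta>) *\<^sub>R sin \<theta> *\<^sub>R A \<sigma> h1 = A \<sigma> h"
      using S False lin by (simp add: h1_def linear_scale)
    ultimately show ?thesis using S False by (simp add: \<sigma>_def h1_def mult_ac)
  qed
  have ode: "(d has_real_derivative
      - (real CARD('n) - 2) * (cos \<theta> / sin \<theta>) * d \<theta> - lam * u \<theta> - u \<theta> powr q) (at \<theta>)"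
    if th: "\<theta> \<in> {0<..<pi/2}" for \<theta>
  proof -
    define \<sigma> \<tau> where "\<sigma> = meridian k e \<theta>" and "\<tau> = meridian_tangent k e \<theta>"
    have sM: "\<sigma> \<in> ?M" and sH: "\<sigma> \<in> upper_hemisphere k"
      unfolding \<sigma>_def using meridian_in[OF e, of \<theta>] th by auto
    have ee: "e \<bullet> e = 1" "\<And>x. ?E \<bullet> x = x $ k" "\<And>x. x \<bullet> ?E = x $ k" "?E $ k = 1"
      using e by (simp_all add: norm_eq_1 inner_axis inner_axis')
    have "((\<lambda>\<theta>. g (meridian k e \<theta>)) has_vector_derivative A \<sigma> \<tau>) (at \<theta> within {0<..<pi/2})"
      unfolding \<sigma>_def \<tau>_def
      by (rule curve[OF gA(3) meridian_derivative(1)]) (use meridian_in(1)[OF e] th in auto)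
    then have "((\<lambda>\<theta>. g (meridian k e \<theta>)) has_vector_derivative A \<sigma> \<tau>) (at \<theta>)"
      unfolding at_within_open[OF th open_greaterThanLessThan] .
    from bounded_bilinear.has_vector_derivative[OF bounded_bilinear_inner this meridian_derivative(2)[of k e]]
    have "(d has_real_derivative g \<sigma> \<bullet> (- \<sigma>) + A \<sigma> \<tau> \<bullet> \<tau>) (at \<theta>)"
      unfolding d_def[abs_def] \<sigma>_def \<tau>_def has_real_derivative_iff_has_vector_derivative .
    then have dd: "(d has_real_derivative A \<sigma> \<tau> \<bullet> \<tau>) (at \<theta>)" using gA(1)[OF sM] by simp
    have lin: "linear (A \<sigma>)" using gA(3)[OF sM] by (rule has_derivative_linear)
    \<comment> \<open>The projection onto the \<open>N - 2\<close> directions orthogonal to the pole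
      and to \<open>e\<close>; there \<open>A \<sigma>\<close> is the multiple of the identity found
      in \<open>rot\<close>.\<close>
    define p where "p b = b - (b $ k) *\<^sub>R ?E - (b \<bullet> e) *\<^sub>R e" for b
    have p: "p b $ k = 0" "p b \<bullet> e = 0" for b
      using e ee(1) ee(2)[of e] by (simp_all add: p_def inner_diff_left axis_def)
    have pb: "p b \<bullet> b = b \<bullet> b - (?E \<bullet> b) * (?E \<bullet> b) - (e \<bullet> b) * (e \<bullet> b)" for b
      by (simp add: p_def inner_diff_left ee inner_commute[of b e])
    have "tangent_proj \<sigma> b = (b \<bullet> \<tau>) *\<^sub>R \<tau> + p b" for b
    proof -
      have "(b \<bullet> \<sigma>) *\<^sub>R \<sigma> + (b \<bullet> \<tau>) *\<^sub>R \<tau>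
          = ((cos \<theta> * cos \<theta> + sin \<theta> * sin \<theta>) * (b $ k)) *\<^sub>R ?E + ((cos \<theta> * cos \<theta> + sin \<theta> * sin \<theta>) * (b \<bullet> e)) *\<^sub>R e"
        by (simp add: \<sigma>_def \<tau>_def meridian_def meridian_tangent_def inner_add_right inner_diff_right ee
            algebra_simps del: sin_cos_squared_add3)
      then have "(b \<bullet> \<sigma>) *\<^sub>R \<sigma> + (b \<bullet> \<tau>) *\<^sub>R \<tau> = (b $ k) *\<^sub>R ?E + (b \<bullet> e) *\<^sub>R e"
        by simp
      then show ?thesis by (simp add: tangent_proj_def p_def algebra_simps)
    qed
    then have "A \<sigma> (tangent_proj \<sigma> b) \<bullet> b = (\<tau> \<bullet> b) * (A \<sigma> \<tau> \<bullet> b)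
        + d \<theta> * (cos \<theta> / sin \<theta>) * (b \<bullet> b - (?E \<bullet> b) * (?E \<bullet> b) - (e \<bullet> b) * (e \<bullet> b))" for b
      using rot[OF th p, folded \<sigma>_def] lin
      unfolding pb[symmetric] by (simp add: linear_add linear_scale inner_add_left inner_commute[of b \<tau>])
    then have "(\<Sum>b\<in>Basis. A \<sigma> (tangent_proj \<sigma> b) \<bullet> b) = (\<Sum>b\<in>Basis. (\<tau> \<bullet> b) * (A \<sigma> \<tau> \<bullet> b)
        + d \<theta> * (cos \<theta> / sin \<theta>) * (1 - (?E \<bullet> b) * (?E \<bullet> b) - (e \<bullet> b) * (e \<bullet> b)))"
      by (intro sum.cong refl) (simp only: inner_same_Basis)
    also have "\<dots> = \<tau> \<bullet> A \<sigma> \<tau> + d \<theta> * (cos \<theta> / sin \<theta>) * (real DIM(real ^ 'n) - ?E \<bullet> ?E - e \<bullet> e)"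
      by (simp only: sum.distrib sum_subtractf sum_distrib_left[symmetric] euclidean_inner[symmetric] sum_constant) simp
    finally have "\<tau> \<bullet> A \<sigma> \<tau> + d \<theta> * (cos \<theta> / sin \<theta>) * (real DIM(real ^ 'n) - ?E \<bullet> ?E - e \<bullet> e)
        = - (lam * v \<sigma> + v \<sigma> powr q)"
      unfolding gA(4)[OF sH] by (rule HOL.sym)
    moreover have "real DIM(real ^ 'n) - ?E \<bullet> ?E - e \<bullet> e = real CARD('n) - 2" by (simp add: ee)
    ultimately have "A \<sigma> \<tau> \<bullet> \<tau> + d \<theta> * (cos \<theta> / sin \<theta>) * (real CARD('n) - 2) = - (lam * v \<sigma> + v \<sigma> powr q)"
      by (simp only: inner_commute)
    moreover have "- (real CARD('n) - 2) * (cos \<theta> / sin \<theta>) * d \<theta>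
        = - (d \<theta> * (cos \<theta> / sin \<theta>) * (real CARD('n) - 2))" by (simp only: mult_ac minus_mult_left)
    ultimately have "A \<sigma> \<tau> \<bullet> \<tau> = - (real CARD('n) - 2) * (cos \<theta> / sin \<theta>) * d \<theta> - lam * v \<sigma> - v \<sigma> powr q"
      by linarith
    then show ?thesis using dd by (simp add: u_def \<sigma>_def)
  qed
  have "radial_solution (real CARD('n) - 2) lam q u d"
    unfolding radial_solution_def
  proof (intro conjI ballI)
    have cm: "continuous_on {0..pi/2} (meridian k e)" "continuous_on {0..pi/2} (meridian_tangent k e)"
      unfolding meridian_def[abs_def] meridian_tangent_def[abs_def] by (intro continuous_intros)+
    have sub: "meridian k e ` {0..pi/2} \<subseteq> ?M" using meridian_in(1)[OF e] by auto
    show "continuous_on {0..pi/2} u"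
      unfolding u_def[abs_def] by (rule continuous_on_compose2[OF positive_solution_continuous[OF v] cm(1) sub])
    have "continuous_on ?M g" using gA(3) by (rule has_derivative_continuous_on)
    then show "continuous_on {0..pi/2} d"
      unfolding d_def[abs_def] by (intro continuous_on_inner continuous_on_compose2[OF _ cm(1) sub] cm(2))
    show "u (pi/2) = 0"
      using v e unfolding u_def positive_solution_def by (simp add: meridian_def hemisphere_boundary_def)
    \<comment> \<open>At the pole the meridians in directions \<open>e\<close> and
      \<open>- e\<close> have opposite tangents but equal slope, so the slope is
      \<open>0\<close>.\<close>
    have "g (meridian k (- e) 0) \<bullet> meridian_tangent k (- e) 0 = d 0"
      using e by (intro slope) auto
    then show "d 0 = 0" by (simp add: d_def meridian_def meridian_tangent_def)
    fix \<theta> :: real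
    show "0 < u \<theta>" if "\<theta> \<in> {0..<pi/2}"
      using v meridian_in(2)[OF e that] unfolding u_def positive_solution_def by blast
    assume th: "\<theta> \<in> {0<..<pi/2}"
    then have "(u has_vector_derivative d \<theta>) (at \<theta> within {0<..<pi/2})"
      unfolding d_def by (intro has_vector_derivative_within_subset[OF du[OF e]]) auto
    then show "(u has_real_derivative d \<theta>) (at \<theta>)"
      unfolding has_real_derivative_iff_has_vector_derivative at_within_open[OF th open_greaterThanLessThan] .
    show "(d has_real_derivative
      - (real CARD('n) - 2) * (cos \<theta> / sin \<theta>) * d \<theta> - lam * u \<theta> - u \<theta> powr q) (at \<theta>)"
      by (rule ode[OF th])
  qed
  then show ?thesis unfolding u_def[abs_def] by blast
qed

theorem theorem1p2:
  fixes k :: "'n::finite" and q lam :: real and v w :: "real ^ 'n \<Rightarrow> real"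
  assumes "CARD('n) \<ge> 4"
    and "1 < q" and "q \<le> (real CARD('n) + 1) / (real CARD('n) - 3)"
    and "positive_solution k lam q v"
    and "positive_solution k lam q w"
  shows "\<forall>\<sigma>\<in>closure (upper_hemisphere k). v \<sigma> = w \<sigma>"
proof
  fix \<sigma> assume s: "\<sigma> \<in> closure (upper_hemisphere k)"
  have "\<exists>j. j \<noteq> k"
  proof (rule ccontr)
    assume "\<nexists>j. j \<noteq> k"
    then have "(UNIV :: 'n set) = {k}" by auto
    then have "CARD('n) = card {k}" by (rule arg_cong)
    then show False using assms(1) by simp
  qed
  then obtain j where "j \<noteq> k" by blast
  define e :: "real ^ 'n" where "e = axis j 1"
  have e: "norm e = 1" "e $ k = 0" using \<open>j \<noteq> k\<close> by (simp_all add: e_def norm_axis_1) (simp add: axis_def)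
  define \<theta> where "\<theta> = arccos (\<sigma> $ k)"
  have sk: "0 \<le> \<sigma> $ k" "\<sigma> $ k \<le> 1"
    using s component_le_norm_cart[of \<sigma> k] by (auto simp: closure_upper_hemisphere)
  have th: "\<theta> \<in> {0..pi/2}" "cos \<theta> = \<sigma> $ k"
    unfolding \<theta>_def using sk arccos_le_pi2[of "\<sigma> $ k"] arccos_lbound[of "\<sigma> $ k"] by auto
  have eq: "f \<sigma> = f (meridian k e \<theta>)" if "positive_solution k lam q f" for f
    using positive_solution_axially_symmetric[OF that assms(2) s meridian_in(1)[OF e th(1)]]
    by (simp add: meridian_height e th)
  obtain d1 d2 where d: "radial_solution (real CARD('n) - 2) lam q (\<lambda>\<theta>. v (meridian k e \<theta>)) d1"
    "radial_solution (real CARD('n) - 2) lam q (\<lambda>\<theta>. w (meridian k e \<theta>)) d2"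
    using positive_solution_radial[OF assms(4,2) e] positive_solution_radial[OF assms(5,2) e] by blast
  have "real CARD('n) - 2 \<ge> 2" using assms(1) by simp
  moreover have "q \<le> (real CARD('n) - 2 + 3) / (real CARD('n) - 2 - 1)" using assms(3) by (simp add: add.commute)
  ultimately have "v (meridian k e \<theta>) = w (meridian k e \<theta>)"
    using radial_solution_unique[OF d _ assms(2) _ th(1)] by simp
  then show "v \<sigma> = w \<sigma>" using eq[OF assms(4)] eq[OF assms(5)] by simp
qed

end
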